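(* Let $\boldsymbol\sigma=(\sigma_n)_{n\in\mathbb Z}\in\mathcal S_d^{\mathbb Z}$, with $d\ge2$, be a sequence of unimodular substitutions that satisfies the tiling condition with compact Rauzy fractals. For all $m,n\in\mathbb Z$ with $m<n$, the induced map of the rotation $\tilde{\mathfrak r}^{(m)}_{\boldsymbol\sigma}$ on the subset $M_{\sigma_{[m,n)}}\mathcal R_n$ of $\mathcal R_m$ equals, after renormalization by the linear map $M_{\sigma_{[m,n)}}$, the rotation $\tilde{\mathfrak r}^{(n)}_{\boldsymbol\sigma}$. That is, if $G$ denotes the first return map of $\tilde{\mathfrak r}^{(m)}_{\boldsymbol\sigma}$ to $M_{\sigma_{[m,n)}}\mathcal R_n\subset\mathcal R_m$, then $G\big(M_{\sigma_{[m,n)}}\mathbf z\big)=M_{\sigma_{[m,n)}}\,\tilde{\mathfrak r}^{(n)}_{\boldsymbol\sigma}(\mathbf z)$ for Lebesgue-almost every $\mathbf z\in\mathcal R_n$.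
   Context: Let $\mathcal A=\{1,\dots,d\}$ and $\mathcal A^*$ the free monoid of finite words over $\mathcal A$. A substitution is an endomorphism $\sigma$ of $\mathcal A^*$ mapping every letter to a nonempty word. $|w|_a$ is the number of occurrences of $a$ in $w$, $\boldsymbol\ell(w)=(|w|_1,\dots,|w|_d)^\top$, and $M_\sigma=(|\sigma(b)|_a)_{a,b\in\mathcal A}$ is the incidence matrix. $\sigma$ is unimodular if $|\det M_\sigma|=1$; $\mathcal S_d$ is the set of unimodular substitutions over $\mathcal A$. $\sigma_{[m,n)}=\sigma_m\circ\cdots\circ\sigma_{n-1}$ for $m\le n$ (identity if $m=n$). $v\preceq w$ means that $v$ is a prefix of $w$. Primitive: for each $m\in\mathbb Z$ there is $n>m$ such that all entries of $M_{\sigma_{[m,n)}}$ are positive. Generalized right (left) eigenvector: $\mathbf u$ (resp. $\mathbf v$) in $\mathbb R_{\ge0}^d\setminus\{\mathbf 0\}$ with $\bigcap_{n\ge0}M_{\sigma_{[0,n)}}\mathbb R^d_{\ge0}=\mathbb R_{\ge0}\mathbf u$ (resp. $\bigcap_{n\ge0}M_{\sigma_{[-n,0)}}^\top\mathbb R^d_{\ge0}=\mathbb R_{\ge0}\mathbf v$). Put $\mathbf u_n=M_{\sigma_{[0,n)}}^{-1}\mathbf u$, $\mathbf v_n=M_{\sigma_{[0,n)}}^\top\mathbf v$ for $n\ge0$ and $\mathbf u_n=M_{\sigma_{[n,0)}}\mathbf u$, $\mathbf v_n=(M_{\sigma_{[n,0)}}^\top)^{-1}\mathbf v$ for $n<0$.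 Let $\pi_n\mathbf x=\mathbf x-\frac{\langle\mathbf x,\mathbf v_n\rangle}{\langle\mathbf u_n,\mathbf v_n\rangle}\mathbf u_n$ and $\tilde\pi_n\mathbf x=\frac{\langle\mathbf x,\mathbf v_n\rangle}{\langle\mathbf u_n,\mathbf v_n\rangle}\mathbf u_n$. Rauzy fractals: $\mathcal R_n(a)$, $a\in\mathcal A$, is the closure of $\{\pi_n\boldsymbol\ell(p): pa\preceq\sigma_{[n,m)}(b)\text{ for infinitely many }m\ge n,\ b\in\mathcal A\}$, and $\mathcal R_n=\bigcup_{a\in\mathcal A}\mathcal R_n(a)\subset\mathbf v_n^\perp$. Rauzy boxes: $\widehat{\mathcal R}_n(a)=\tilde\pi_n\llbracket\mathbf e_a\rrbracket-\mathcal R_n(a)$ (Minkowski difference), where $\llbracket\mathbf x\rrbracket$ is the closed segment from $\mathbf 0$ to $\mathbf x$. Tiling condition: $\boldsymbol\sigma$ is primitive, admits generalized right and left eigenvectors, and for every $n\in\mathbb Z$ the collection $\{\mathbf x+\widehat{\mathcal R}_n(a):\mathbf x\in\mathbb Z^d,a\in\mathcal A\}$ is a tiling of $\mathbb R^d$, i.e. it covers $\mathbb R^d$ by closed sets and distinct tiles intersect in Lebesgue measure zero. Let $\mathbf 1=(1,\dots,1)^\top$. Then $\mathbf v_n^\perp/\pi_n(\mathbb Z^d\cap\mathbf 1^\perp)$ is a $(d-1)$-dimensional torus having $\mathcal R_n$ as a (measurable) fundamental domain, and the rotation $\tilde{\mathfrak r}^{(n)}_{\boldsymbol\sigma}:\mathcal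 R_n\to\mathcal R_n$ is defined (a.e.) by $\mathbf z\mapsto\mathbf z+\pi_n\mathbf e_d\bmod\pi_n(\mathbb Z^d\cap\mathbf 1^\perp)$. It is equipped with Lebesgue measure. The induced map of a map $F$ on a subset $Y$ is the first return map $x\mapsto F^{n(x)}(x)$, $n(x)=\min\{k\ge1:F^k(x)\in Y\}$. *)

theory Defs
  imports "HOL-Analysis.Analysis" "HOL-Library.Sublist"
begin

text \<open>The alphabet $\{1,\dots,d\}$ is a finite linearly ordered type \<open>'d\<close> with
  \<open>CARD('d) = d\<close>; its last letter $d$ is \<open>Max UNIV\<close>. Words are lists.\<close>

definition substitution :: "('d list \<Rightarrow> 'd list) \<Rightarrow> bool" where
  "substitution s \<longleftrightarrow> (\<forall>x y. s (x @ y) = s x @ s y) \<and> (\<forall>a. s [a] \<noteq> [])"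

definition abelianization :: "'d::finite list \<Rightarrow> real ^ 'd" where
  "abelianization w = (\<chi> a. real (count_list w a))"

definition incidence :: "('d::finite list \<Rightarrow> 'd list) \<Rightarrow> real ^ 'd ^ 'd" where
  "incidence s = (\<chi> a b. real (count_list (s [b]) a))"

definition unimodular :: "('d::finite list \<Rightarrow> 'd list) \<Rightarrow> bool" where
  "unimodular s \<longleftrightarrow> \<bar>det (incidence s)\<bar> = 1"

text \<open>\<open>subst_range \<sigma> m n\<close> is $\sigma_m \circ \cdots \circ \sigma_{n-1}$, and the identity if $m = n$.\<close>

definition subst_range :: "(int \<Rightarrow> 'd::finite list \<Rightarrow> 'd list) \<Rightarrow> int \<Rightarrow> int \<Rightarrow> 'd list \<Rightarrow> 'd list" where
  "subst_range \<sigma> m n = foldr \<sigma> [m..n - 1]"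

definition inc_range :: "(int \<Rightarrow> 'd::finite list \<Rightarrow> 'd list) \<Rightarrow> int \<Rightarrow> int \<Rightarrow> real ^ 'd ^ 'd" where
  "inc_range \<sigma> m n = incidence (subst_range \<sigma> m n)"

definition primitive_seq :: "(int \<Rightarrow> 'd::finite list \<Rightarrow> 'd list) \<Rightarrow> bool" where
  "primitive_seq \<sigma> \<longleftrightarrow> (\<forall>m. \<exists>n>m. \<forall>a b. inc_range \<sigma> m n $ a $ b > 0)"

definition nonneg_cone :: "(real ^ 'd::finite) set" where
  "nonneg_cone = {x. \<forall>a. 0 \<le> x $ a}"

definition gen_right_eigenvector ::
    "(int \<Rightarrow> 'd::finite list \<Rightarrow> 'd list) \<Rightarrow> real ^ 'd \<Rightarrow> bool" where
  "gen_right_eigenvector \<sigma> u \<longleftrightarrow> u \<in> nonneg_cone - {0} \<and>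
     (\<Inter>n::nat. (\<lambda>x. inc_range \<sigma> 0 (int n) *v x) ` nonneg_cone) = {t *\<^sub>R u | t. 0 \<le> t}"

definition gen_left_eigenvector ::
    "(int \<Rightarrow> 'd::finite list \<Rightarrow> 'd list) \<Rightarrow> real ^ 'd \<Rightarrow> bool" where
  "gen_left_eigenvector \<sigma> v \<longleftrightarrow> v \<in> nonneg_cone - {0} \<and>
     (\<Inter>n::nat. (\<lambda>x. transpose (inc_range \<sigma> (- int n) 0) *v x) ` nonneg_cone)
       = {t *\<^sub>R v | t. 0 \<le> t}"

definition right_vec ::
    "(int \<Rightarrow> 'd::finite list \<Rightarrow> 'd list) \<Rightarrow> real ^ 'd \<Rightarrow> int \<Rightarrow> real ^ 'd" where
  "right_vec \<sigma> u n = (if n \<ge> 0 then matrix_inv (inc_range \<sigma> 0 n) *v u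
                      else inc_range \<sigma> n 0 *v u)"

definition left_vec ::
    "(int \<Rightarrow> 'd::finite list \<Rightarrow> 'd list) \<Rightarrow> real ^ 'd \<Rightarrow> int \<Rightarrow> real ^ 'd" where
  "left_vec \<sigma> v n = (if n \<ge> 0 then transpose (inc_range \<sigma> 0 n) *v v
                     else matrix_inv (transpose (inc_range \<sigma> n 0)) *v v)"

text \<open>In what follows \<open>u\<close> and \<open>v\<close> are generalized right and left eigenvectors of \<open>\<sigma>\<close>. These are
  unique up to positive factors, on which the projections below do not depend.\<close>

definition proj_along ::
    "(int \<Rightarrow> 'd::finite list \<Rightarrow> 'd list) \<Rightarrow> real ^ 'd \<Rightarrow> real ^ 'd \<Rightarrow> int \<Rightarrow> real ^ 'd \<Rightarrow> real ^ 'd" where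
  "proj_along \<sigma> u v n x =
     x - ((x \<bullet> left_vec \<sigma> v n) / (right_vec \<sigma> u n \<bullet> left_vec \<sigma> v n)) *\<^sub>R right_vec \<sigma> u n"

definition proj_onto ::
    "(int \<Rightarrow> 'd::finite list \<Rightarrow> 'd list) \<Rightarrow> real ^ 'd \<Rightarrow> real ^ 'd \<Rightarrow> int \<Rightarrow> real ^ 'd \<Rightarrow> real ^ 'd" where
  "proj_onto \<sigma> u v n x =
     ((x \<bullet> left_vec \<sigma> v n) / (right_vec \<sigma> u n \<bullet> left_vec \<sigma> v n)) *\<^sub>R right_vec \<sigma> u n"

definition subfractal ::
    "(int \<Rightarrow> 'd::finite list \<Rightarrow> 'd list) \<Rightarrow> real ^ 'd \<Rightarrow> real ^ 'd \<Rightarrow> int \<Rightarrow> 'd \<Rightarrow> (real ^ 'd) set" where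
  "subfractal \<sigma> u v n a = closure {proj_along \<sigma> u v n (abelianization p) | p.
     infinite {(m, b). n \<le> m \<and> prefix (p @ [a]) (subst_range \<sigma> n m [b])}}"

definition fractal ::
    "(int \<Rightarrow> 'd::finite list \<Rightarrow> 'd list) \<Rightarrow> real ^ 'd \<Rightarrow> real ^ 'd \<Rightarrow> int \<Rightarrow> (real ^ 'd) set" where
  "fractal \<sigma> u v n = (\<Union>a. subfractal \<sigma> u v n a)"

definition rauzy_box ::
    "(int \<Rightarrow> 'd::finite list \<Rightarrow> 'd list) \<Rightarrow> real ^ 'd \<Rightarrow> real ^ 'd \<Rightarrow> int \<Rightarrow> 'd \<Rightarrow> (real ^ 'd) set" where
  "rauzy_box \<sigma> u v n a =
     {y - z | y z. y \<in> proj_onto \<sigma> u v n ` closed_segment 0 (axis a 1) \<and> z \<in> subfractal \<sigma> u v n a}"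

definition int_lattice :: "(real ^ 'd::finite) set" where
  "int_lattice = {x. \<forall>a. x $ a \<in> \<int>}"

text \<open>Tilings are indexed families: tiles with different indices overlap in a null set.\<close>

definition is_tiling :: "'i set \<Rightarrow> ('i \<Rightarrow> 'a::euclidean_space set) \<Rightarrow> bool" where
  "is_tiling I T \<longleftrightarrow> (\<forall>i\<in>I. closed (T i)) \<and> (\<Union>i\<in>I. T i) = UNIV \<and>
     (\<forall>i\<in>I. \<forall>j\<in>I. i \<noteq> j \<longrightarrow> T i \<inter> T j \<in> null_sets lebesgue)"

definition tiling_condition ::
    "(int \<Rightarrow> 'd::finite list \<Rightarrow> 'd list) \<Rightarrow> real ^ 'd \<Rightarrow> real ^ 'd \<Rightarrow> bool" where
  "tiling_condition \<sigma> u v \<longleftrightarrow> primitive_seq \<sigma> \<and>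
     gen_right_eigenvector \<sigma> u \<and> gen_left_eigenvector \<sigma> v \<and>
     (\<forall>n. is_tiling (int_lattice \<times> UNIV) (\<lambda>(x, a). (+) x ` rauzy_box \<sigma> u v n a))"

text \<open>Lebesgue measure (on Borel sets) of a linear subspace \<open>S\<close>, as a measure on the ambient space
  concentrated on \<open>S\<close>: the image of the product Lebesgue measure under the coordinates given by an
  orthonormal basis of \<open>S\<close>, by analogy with the definition of \<open>lborel\<close>. It does not depend on the
  choice of the basis.\<close>

definition lborel_subspace :: "'a::euclidean_space set \<Rightarrow> 'a measure" where
  "lborel_subspace S =
     (let B = (SOME B. pairwise orthogonal B \<and> (\<forall>b\<in>B. norm b = 1) \<and> span B = S)
      in distr (\<Pi>\<^sub>M b\<in>B. lborel) borel (\<lambda>f. \<Sum>b\<in>B. f b *\<^sub>R b))"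

definition translation_lattice ::
    "(int \<Rightarrow> 'd::finite list \<Rightarrow> 'd list) \<Rightarrow> real ^ 'd \<Rightarrow> real ^ 'd \<Rightarrow> int \<Rightarrow> (real ^ 'd) set" where
  "translation_lattice \<sigma> u v n = proj_along \<sigma> u v n ` (int_lattice \<inter> {x. x \<bullet> 1 = 0})"

text \<open>The rotation is only defined almost everywhere, hence a partial map: its value at a point of
  the fractal is the representative in the fractal of the translated point modulo the lattice, and
  it is undefined where this representative is missing or not unique.\<close>

definition rotation ::
    "(int \<Rightarrow> 'd::{finite,linorder} list \<Rightarrow> 'd list) \<Rightarrow> (real, 'd) vec \<Rightarrow> (real, 'd) vec \<Rightarrow> int
       \<Rightarrow> (real, 'd) vec \<rightharpoonup> (real, 'd) vec" where
  "rotation \<sigma> u v n z =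
     (let P = (\<lambda>w. w \<in> fractal \<sigma> u v n \<and>
                 w - (z + proj_along \<sigma> u v n (axis (Max UNIV) 1)) \<in> translation_lattice \<sigma> u v n)
      in if z \<in> fractal \<sigma> u v n \<and> (\<exists>!w. P w) then Some (THE w. P w) else None)"

definition partial_iterate :: "('a \<rightharpoonup> 'a) \<Rightarrow> nat \<Rightarrow> 'a \<rightharpoonup> 'a" where
  "partial_iterate F k x = ((\<lambda>y. Option.bind y F) ^^ k) (Some x)"

definition induced_map :: "('a \<rightharpoonup> 'a) \<Rightarrow> 'a set \<Rightarrow> 'a \<rightharpoonup> 'a" where
  "induced_map F Y x =
     (if x \<in> Y \<and> (\<exists>k\<ge>1. partial_iterate F k x \<in> Some ` Y)
      then partial_iterate F (LEAST k. k \<ge> 1 \<and> partial_iterate F k x \<in> Some ` Y) x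
      else None)"

end

theory Submission imports Defs begin

text \<open>On $\mathcal R_n(a)$ the rotation is the domain exchange $z \mapsto z + \pi_n e_a$. The tiling shows
  that, up to a null set, every pair $z$, $z + \pi_n x$ of points of $\mathcal R_n$ with $x \in \mathbb Z^d$
  consists of two points of one orbit of the domain exchange, and $x$ is (up to sign) the
  abelianization of the itinerary between them: the orbit of $z$ lifts to a staircase of tiles along
  the line $-z + \mathbb R u_n$, and if the staircase passed by the tile of $z + \pi_n x$, two distinct
  tiles would overlap in a segment of this line. This argument needs $v_n > 0$, which holds for all
  large $n$ only (primitivity is a condition on the future). Writing
  $z = M_{\sigma_{[m,n)}} z' + \pi_m \ell(p)$ with $z' \in \mathcal R_n(b)$ and $p$ a proper prefix of
  $\sigma_{[m,n)}(b)$ transports the statement from large $n$ to all smaller $m$.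

  The orbit of $M_{\sigma_{[m,n)}} z$, $z \in \mathcal R_n(b)$, reads the letters of $\sigma_{[m,n)}(b)$ and then
  arrives at $M_{\sigma_{[m,n)}}(z + \pi_n e_b)$. An earlier visit to $M_{\sigma_{[m,n)}} \mathcal R_n$, after a proper
  nonempty prefix $p$, would give a pair as above with $x = M_{\sigma_{[m,n)}}^{-1} \ell(p)$, so that
  $\ell(p)$ or $-\ell(p)$ would be the abelianization of a word at least as long as
  $\sigma_{[m,n)}(b)$ or as some other $\sigma_{[m,n)}(c)$; neither is possible.\<close>

section \<open>Substitutions and their incidence matrices\<close>

declare transpose_matrix_vector [simp del]

lemma substitution_append: "substitution s \<Longrightarrow> s (x @ y) = s x @ s y"
  by (simp add: substitution_def)

lemma substitution_Nil: "substitution s \<Longrightarrow> s [] = []"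
  using substitution_append[of s "[]" "[]"] by simp

lemma substitution_Cons: "substitution s \<Longrightarrow> s (a # x) = s [a] @ s x"
  using substitution_append[of s "[a]" x] by simp

lemma substitution_letter: "substitution s \<Longrightarrow> s [a] \<noteq> []"
  by (simp add: substitution_def)

lemma substitution_comp: "substitution s \<Longrightarrow> substitution t \<Longrightarrow> substitution (s \<circ> t)"
  unfolding substitution_def
  by (metis (no_types, lifting) comp_apply substitution_Cons substitution_def Nil_is_append_conv list.exhaust)

lemma length_substitution:
  assumes "substitution s"
  shows "length x \<le> length (s x)"
proof (induction x)
  case (Cons a x)
  then show ?case
    using substitution_Cons[OF assms, of a x] substitution_letter[OF assms, of a]
    by (cases "s [a]") auto
qed simp

lemma abelianization_simps [simp]:
  "abelianization [] = 0"
  "abelianization (a # x) = axis a 1 + abelianization x"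
  "abelianization (x @ y) = abelianization x + abelianization y"
  by (auto simp: abelianization_def vec_eq_iff axis_def)

lemma abelianization_inner_1: "abelianization x \<bullet> 1 = real (length x)"
  by (induction x) (auto simp: inner_add_left inner_axis')

lemma abelianization_substitution:
  assumes "substitution s"
  shows "abelianization (s x) = incidence s *v abelianization x"
proof (induction x)
  case (Cons a x)
  have "abelianization (s [a]) = incidence s *v axis a 1"
    by (simp add: matrix_vector_mul_component matrix_vector_mult_basis column_def vec_eq_iff
        abelianization_def incidence_def)
  with Cons show ?case
    by (simp add: substitution_Cons[OF assms, of a x] matrix_vector_right_distrib)
qed (simp add: substitution_Nil[OF assms])

lemma incidence_comp:
  assumes "substitution s" "substitution t"
  shows "incidence (s \<circ> t) = incidence s ** incidence t"
proof -
  have "incidence (s \<circ> t) $ a $ b = (incidence s ** incidence t) $ a $ b" for a b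
    using arg_cong[where f = "\<lambda>x. x $ a", OF abelianization_substitution[OF assms(1), of "t [b]"]]
    by (simp add: incidence_def abelianization_def matrix_matrix_mult_def matrix_vector_mult_def)
  then show ?thesis by (simp add: vec_eq_iff)
qed

lemma incidence_id [simp]: "incidence id = mat 1"
  by (auto simp: incidence_def mat_def vec_eq_iff)

lemma incidence_column_nonzero:
  assumes "substitution s"
  obtains a where "incidence s $ a $ b \<ge> 1"
proof -
  obtain a where "a \<in> set (s [b])"
    using substitution_letter[OF assms, of b] by (cases "s [b]") auto
  then have "count_list (s [b]) a \<noteq> 0" by (simp add: count_list_0_iff)
  then have "incidence s $ a $ b \<ge> 1" by (simp add: incidence_def)
  then show ?thesis ..
qed

text \<open>Desubstitution of a marked position: the letter a after p in \<open>s w\<close> lies in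
  the image of one letter b of w. The word \<open>p'\<close> is what precedes b, and q is the offset
  of a inside \<open>s [b]\<close>. Peeling off the first letter of w locates b.\<close>

lemma prefix_substitution_split:
  assumes "substitution s" "prefix (p @ [a]) (s w)"
  obtains p' b q where "prefix (p' @ [b]) w" "p = s p' @ q" "prefix (q @ [a]) (s [b])"
proof -
  have "\<exists>p' b q. prefix (p' @ [b]) w \<and> p = s p' @ q \<and> prefix (q @ [a]) (s [b])"
    using assms(2)
  proof (induction w arbitrary: p)
    case Nil
    then show ?case by (simp add: substitution_Nil[OF assms(1)])
  next
    case (Cons c w)
    have eq: "s (c # w) = s [c] @ s w" by (rule substitution_Cons[OF assms(1)])
    consider "prefix (p @ [a]) (s [c])" | r where "p @ [a] = s [c] @ r" "r \<noteq> []" "prefix r (s w)"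
      using Cons.prems unfolding eq prefix_append by fastforce
    then show ?case
    proof cases
      case 1
      then show ?thesis
        by (intro exI[of _ "[]"] exI[of _ c] exI[of _ p]) (simp add: substitution_Nil[OF assms(1)])
    next
      case 2
      then obtain p1 where p1: "r = p1 @ [a]" "p = s [c] @ p1"
        by (cases r rule: rev_cases) auto
      then obtain p' b q where "prefix (p' @ [b]) w" "p1 = s p' @ q" "prefix (q @ [a]) (s [b])"
        using Cons.IH[of p1] 2 by auto
      then show ?thesis
        using p1 substitution_Cons[OF assms(1), of c p']
        by (intro exI[of _ "c # p'"] exI[of _ b] exI[of _ q]) simp
    qed
  qed
  then show ?thesis using that by blast
qed

section \<open>Linear algebra of unimodular integer matrices and the integer lattice\<close>

lemma inner_matrix_vector_transpose:
  fixes A :: "real ^ 'n ^ 'm"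
  shows "(A *v x) \<bullet> y = x \<bullet> (transpose A *v y)"
  by (metis dot_lmul_matrix inner_commute transpose_matrix_vector)

lemma matrix_inv_mult_vec:
  fixes A :: "real ^ 'n ^ 'n"
  assumes "invertible A"
  shows "A *v (matrix_inv A *v x) = x" "matrix_inv A *v (A *v x) = x"
proof -
  have "A ** matrix_inv A = mat 1 \<and> matrix_inv A ** A = mat 1"
    unfolding matrix_inv_def using assms[unfolded invertible_def] by (rule someI_ex)
  then show "A *v (matrix_inv A *v x) = x" "matrix_inv A *v (A *v x) = x"
    by (simp_all add: matrix_vector_mul_assoc)
qed

lemma matrix_inv_mult_eq_iff:
  fixes A :: "real ^ 'n ^ 'n"
  assumes "invertible A"
  shows "matrix_inv A *v x = y \<longleftrightarrow> x = A *v y"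
  using matrix_inv_mult_vec[OF assms] by metis

lemma det_Ints: "(\<And>i j. A $ i $ j \<in> \<int>) \<Longrightarrow> det A \<in> (\<int> :: real set)" for A :: "real ^ 'n ^ 'n"
  unfolding det_def by (intro Ints_sum Ints_mult Ints_prod) (auto simp: sign_def)

lemma int_lattice_add: "x \<in> int_lattice \<Longrightarrow> y \<in> int_lattice \<Longrightarrow> x + y \<in> int_lattice"
  and int_lattice_diff: "x \<in> int_lattice \<Longrightarrow> y \<in> int_lattice \<Longrightarrow> x - y \<in> int_lattice"
  and int_lattice_minus: "x \<in> int_lattice \<Longrightarrow> - x \<in> int_lattice"
  and int_lattice_axis: "axis a 1 \<in> int_lattice"
  and abelianization_int_lattice: "abelianization w \<in> int_lattice"
  by (auto simp: int_lattice_def axis_def abelianization_def)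

text \<open>By Cramer's rule each coordinate is an integer determinant divided by
  \<open>det A\<close>, which is 1 or -1.\<close>

lemma int_lattice_matrix_inv:
  fixes A :: "real ^ 'n ^ 'n"
  assumes A: "\<And>i j. A $ i $ j \<in> \<int>" and det: "\<bar>det A\<bar> = 1" and x: "x \<in> int_lattice"
  shows "matrix_inv A *v x \<in> int_lattice"
proof -
  have nz: "det A \<noteq> 0" and sgn: "det A = 1 \<or> det A = - 1" using det by auto
  have "A *v (matrix_inv A *v x) = x"
    using nz by (simp add: matrix_inv_mult_vec invertible_det_nz)
  then have "matrix_inv A *v x = (\<chi> k. det (\<chi> i j. if j = k then x $ i else A $ i $ j) / det A)"
    using cramer[OF nz] by blast
  moreover have "det (\<chi> i j. if j = k then x $ i else A $ i $ j) \<in> \<int>" for k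
    using A x by (intro det_Ints) (auto simp: int_lattice_def)
  ultimately show ?thesis using sgn by (auto simp: int_lattice_def)
qed

lemma countable_int_lattice: "countable (int_lattice :: (real ^ 'd) set)"
proof (rule countable_subset)
  show "int_lattice \<subseteq> range (\<lambda>f :: 'd \<Rightarrow> int. \<chi> a. real_of_int (f a))"
  proof
    fix x :: "real ^ 'd" assume "x \<in> int_lattice"
    then have "\<forall>a. \<exists>k. x $ a = of_int k" by (auto simp: int_lattice_def elim: Ints_cases)
    then obtain f where "\<forall>a. x $ a = of_int (f a)" by metis
    then show "x \<in> range (\<lambda>f. \<chi> a. of_int (f a))" by (auto simp: vec_eq_iff)
  qed
qed simp

section \<open>Cocycle rules for incidence matrices, eigenvectors and projections\<close>

locale unimodular_seq =
  fixes \<sigma> :: "int \<Rightarrow> 'd::finite list \<Rightarrow> 'd list"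
  assumes subst: "\<And>k. substitution (\<sigma> k)"
    and unimod: "\<And>k. unimodular (\<sigma> k)"
begin

lemma subst_range_refl [simp]: "subst_range \<sigma> n n = id"
  by (simp add: subst_range_def fun_eq_iff)

lemma subst_range_comp:
  assumes "m \<le> n" "n \<le> k"
  shows "subst_range \<sigma> m k = subst_range \<sigma> m n \<circ> subst_range \<sigma> n k"
proof (cases "n = k")
  case False
  then have "[m..k - 1] = [m..n - 1] @ [n..k - 1]"
    using assms by (intro upto_split1) auto
  then show ?thesis by (simp add: subst_range_def fun_eq_iff)
qed simp

lemma subst_range_single: "subst_range \<sigma> n (n + 1) = \<sigma> n"
  by (simp add: subst_range_def fun_eq_iff)

text \<open>The list \<open>[m..n - 1]\<close> is then empty. This settles reversed ranges, so that
  invertibility of \<open>inc_range\<close> can be an unconditional simp rule.\<close>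

lemma subst_range_empty: "n \<le> m \<Longrightarrow> subst_range \<sigma> m n = id"
  by (simp add: subst_range_def fun_eq_iff)

lemma substitution_range: "substitution (subst_range \<sigma> m n)"
proof (cases "m \<le> n")
  case True
  then show ?thesis
  proof (induction n rule: int_ge_induct)
    case base
    then show ?case by (simp add: substitution_def)
  next
    case (step n)
    then show ?case
      using subst_range_comp[of m n "n + 1"] substitution_comp[OF _ subst[of n]] subst_range_single[of n]
      by (metis zle_add1_eq_le less_add_one less_imp_le)
  qed
next
  case False
  then show ?thesis by (simp add: subst_range_empty substitution_def)
qed

lemma inc_range_refl [simp]: "inc_range \<sigma> n n = mat 1"
  by (simp add: inc_range_def)

lemma inc_range_comp:
  "m \<le> n \<Longrightarrow> n \<le> k \<Longrightarrow> inc_range \<sigma> m k = inc_range \<sigma> m n ** inc_range \<sigma> n k"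
  by (simp add: inc_range_def subst_range_comp[of m n k] incidence_comp substitution_range)

lemma inc_range_vec_comp:
  "m \<le> n \<Longrightarrow> n \<le> k \<Longrightarrow> inc_range \<sigma> m n *v (inc_range \<sigma> n k *v x) = inc_range \<sigma> m k *v x"
  by (simp add: inc_range_comp[of m n k] matrix_vector_mul_assoc)

lemma inc_range_transpose_vec_comp:
  "m \<le> n \<Longrightarrow> n \<le> k \<Longrightarrow>
    transpose (inc_range \<sigma> n k) *v (transpose (inc_range \<sigma> m n) *v x) = transpose (inc_range \<sigma> m k) *v x"
  by (simp add: inc_range_comp[of m n k] matrix_vector_mul_assoc matrix_transpose_mul)

lemma inc_range_Ints: "inc_range \<sigma> m n $ a $ b \<in> \<int>"
  by (simp add: inc_range_def incidence_def)

lemma inc_range_nonneg: "inc_range \<sigma> m n $ a $ b \<ge> 0"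
  by (simp add: inc_range_def incidence_def)

lemma abelianization_range:
  "abelianization (subst_range \<sigma> m n x) = inc_range \<sigma> m n *v abelianization x"
  by (simp add: inc_range_def abelianization_substitution substitution_range)

lemma det_inc_range: "\<bar>det (inc_range \<sigma> m n)\<bar> = 1"
proof (cases "m \<le> n")
  case True
  then show ?thesis
  proof (induction n rule: int_ge_induct)
    case (step n)
    have "inc_range \<sigma> n (n + 1) = incidence (\<sigma> n)"
      by (simp add: inc_range_def subst_range_single)
    then show ?case
      using step inc_range_comp[of m n "n + 1"] unimod[of n]
      by (simp add: unimodular_def det_mul abs_mult)
  qed simp
next
  case False
  then show ?thesis by (simp add: inc_range_def subst_range_empty)
qed

lemma invertible_inc_range [simp]: "invertible (inc_range \<sigma> m n)"
  using det_inc_range[of m n] by (auto simp: invertible_det_nz)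

lemma invertible_transpose_inc_range [simp]: "invertible (transpose (inc_range \<sigma> m n))"
  using det_inc_range[of m n] by (auto simp: invertible_det_nz)

lemma inv_inc_range_int_lattice: "x \<in> int_lattice \<Longrightarrow> matrix_inv (inc_range \<sigma> m n) *v x \<in> int_lattice"
  by (intro int_lattice_matrix_inv inc_range_Ints det_inc_range)

text \<open>The definition of \<open>right_vec\<close> starts from level 0. Splitting by the
  position of 0 relative to m and n reduces each case to the cocycle rule; afterwards level 0 is no
  longer distinguished.\<close>

lemma right_vec_step:
  assumes "m \<le> n"
  shows "inc_range \<sigma> m n *v right_vec \<sigma> u n = right_vec \<sigma> u m"
proof -
  consider "0 \<le> m" | "m < 0" "0 \<le> n" | "n < 0" by linarith
  then show ?thesis
  proof cases
    case 1
    then have "u = inc_range \<sigma> 0 m *v (inc_range \<sigma> m n *v right_vec \<sigma> u n)"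
      using assms by (simp add: inc_range_vec_comp right_vec_def matrix_inv_mult_vec)
    then have "inc_range \<sigma> m n *v right_vec \<sigma> u n = matrix_inv (inc_range \<sigma> 0 m) *v u"
      using matrix_inv_mult_vec(2)[OF invertible_inc_range] by metis
    then show ?thesis using 1 by (simp add: right_vec_def)
  next
    case 2
    have "inc_range \<sigma> m n *v right_vec \<sigma> u n = inc_range \<sigma> m 0 *v (inc_range \<sigma> 0 n *v right_vec \<sigma> u n)"
      using 2 by (simp add: inc_range_vec_comp)
    then show ?thesis using 2 by (simp add: right_vec_def matrix_inv_mult_vec)
  next
    case 3
    then show ?thesis using assms by (simp add: right_vec_def inc_range_vec_comp)
  qed
qed

lemma left_vec_step:
  assumes "m \<le> n"
  shows "transpose (inc_range \<sigma> m n) *v left_vec \<sigma> v m = left_vec \<sigma> v n"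
proof -
  consider "0 \<le> m" | "m < 0" "0 \<le> n" | "n < 0" by linarith
  then show ?thesis
  proof cases
    case 1
    then show ?thesis using assms by (simp add: left_vec_def inc_range_transpose_vec_comp)
  next
    case 2
    have "transpose (inc_range \<sigma> m n) *v left_vec \<sigma> v m =
        transpose (inc_range \<sigma> 0 n) *v (transpose (inc_range \<sigma> m 0) *v left_vec \<sigma> v m)"
      using 2 by (simp add: inc_range_transpose_vec_comp)
    then show ?thesis using 2 by (simp add: left_vec_def matrix_inv_mult_vec)
  next
    case 3
    then have "v = transpose (inc_range \<sigma> n 0) *v (transpose (inc_range \<sigma> m n) *v left_vec \<sigma> v m)"
      using assms by (simp add: inc_range_transpose_vec_comp left_vec_def matrix_inv_mult_vec)
    then have "left_vec \<sigma> v n = transpose (inc_range \<sigma> m n) *v left_vec \<sigma> v m"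
      unfolding left_vec_def using 3 matrix_inv_mult_vec(2)[OF invertible_transpose_inc_range]
      by (metis not_le)
    then show ?thesis ..
  qed
qed

lemma inner_left_vec_step:
  "m \<le> n \<Longrightarrow> (inc_range \<sigma> m n *v x) \<bullet> left_vec \<sigma> v m = x \<bullet> left_vec \<sigma> v n"
  by (simp add: inner_matrix_vector_transpose left_vec_step)

text \<open>The matrix moves from one side of the pairing to the other. The constancy makes the
  projections equivariant and lets positivity of the pairing be checked at one convenient
  level.\<close>

lemma right_inner_left_const:
  assumes "m \<le> n"
  shows "right_vec \<sigma> u m \<bullet> left_vec \<sigma> v m = right_vec \<sigma> u n \<bullet> left_vec \<sigma> v n"
  using inner_left_vec_step[OF assms, of "right_vec \<sigma> u n" v] by (simp add: right_vec_step[OF assms])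

lemma proj_along_step:
  assumes "m \<le> n"
  shows "inc_range \<sigma> m n *v proj_along \<sigma> u v n x = proj_along \<sigma> u v m (inc_range \<sigma> m n *v x)"
  by (simp add: proj_along_def matrix_vector_mult_diff_distrib matrix_vector_mult_scaleR
      right_vec_step[OF assms] right_inner_left_const[OF assms] inner_left_vec_step[OF assms])

lemma proj_along_add: "proj_along \<sigma> u v n (x + y) = proj_along \<sigma> u v n x + proj_along \<sigma> u v n y"
  by (simp add: proj_along_def inner_add_left add_divide_distrib scaleR_add_left)

lemma proj_along_diff: "proj_along \<sigma> u v n (x - y) = proj_along \<sigma> u v n x - proj_along \<sigma> u v n y"
  by (simp add: proj_along_def inner_diff_left diff_divide_distrib scaleR_diff_left)

lemma proj_along_minus: "proj_along \<sigma> u v n (- x) = - proj_along \<sigma> u v n x"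
  by (simp add: proj_along_def)

lemma proj_along_0 [simp]: "proj_along \<sigma> u v n 0 = 0"
  by (simp add: proj_along_def)

end

section \<open>Growth of word lengths under primitivity\<close>

locale primitive_unimodular_seq = unimodular_seq \<sigma>
  for \<sigma> :: "int \<Rightarrow> 'd::finite list \<Rightarrow> 'd list" +
  assumes card: "CARD('d) \<ge> 2" and prim: "primitive_seq \<sigma>"
begin

text \<open>Over a positive block every letter image contains all letters, hence at least two. If
  all images up to level k are longer than L, then after one more such block they contain two of
  these and are longer than L + 1. Further substitutions never shorten a word.\<close>

lemma length_range_unbounded:
  "\<exists>k0\<ge>n. \<forall>k\<ge>k0. \<forall>b. length (subst_range \<sigma> n k [b]) > L"
proof -
  have "\<exists>k\<ge>n. \<forall>b. length (subst_range \<sigma> n k [b]) > L"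
  proof (induction L)
    case 0
    show ?case using substitution_letter[OF substitution_range]
      by (intro exI[of _ n]) auto
  next
    case (Suc L)
    then obtain k where k: "k \<ge> n" "\<And>b. length (subst_range \<sigma> n k [b]) > L" by blast
    obtain l where l: "l > k" "\<And>a b. inc_range \<sigma> k l $ a $ b > 0"
      using prim unfolding primitive_seq_def by blast
    have "length (subst_range \<sigma> n l [b]) > Suc L" for b
    proof -
      let ?w = "subst_range \<sigma> k l [b]"
      have "a \<in> set ?w" for a
        using l(2)[of a b] count_list_0_iff[of ?w a] by (auto simp: inc_range_def incidence_def)
      then have "CARD('d) \<le> length ?w"
        using card_length[of ?w] by (metis UNIV_eq_I)
      then have "Suc (Suc 0) \<le> length ?w" using card by simp
      then obtain x y w where w: "?w = x # y # w"
        by (metis Suc_le_length_iff)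
      have "subst_range \<sigma> n l [b] = subst_range \<sigma> n k [x] @ subst_range \<sigma> n k [y] @ subst_range \<sigma> n k w"
        using k l w subst_range_comp[of n k l] substitution_Cons[OF substitution_range[of n k], of x "y # w"]
          substitution_Cons[OF substitution_range[of n k], of y w]
        by simp
      then show ?thesis using k(2)[of x] k(2)[of y] by simp
    qed
    then show ?case using k l by (meson dual_order.trans less_imp_le)
  qed
  then obtain k0 where k0: "k0 \<ge> n" "\<And>b. length (subst_range \<sigma> n k0 [b]) > L" by blast
  have "length (subst_range \<sigma> n k [b]) > L" if "k \<ge> k0" for k b
  proof -
    obtain x w where w: "subst_range \<sigma> k0 k [b] = x # w"
      using substitution_letter[OF substitution_range] by (meson list.exhaust)
    have "subst_range \<sigma> n k [b] = subst_range \<sigma> n k0 (x # w)"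
      using subst_range_comp[OF k0(1) that] w by simp
    also have "\<dots> = subst_range \<sigma> n k0 [x] @ subst_range \<sigma> n k0 w"
      by (rule substitution_Cons[OF substitution_range])
    finally have "subst_range \<sigma> n k [b] = subst_range \<sigma> n k0 [x] @ subst_range \<sigma> n k0 w" .
    then show ?thesis using k0(2)[of x] by simp
  qed
  then show ?thesis using k0 by blast
qed

end

section \<open>Refinement of Rauzy fractals\<close>

context primitive_unimodular_seq
begin

text \<open>Words whose projections are dense in R_n(a). Extension, refinement and coarsening are
  proved for these words first and then pass to the closure.\<close>

definition address :: "int \<Rightarrow> 'd \<Rightarrow> 'd list set" where
  "address n a = {p. infinite {(m, b). n \<le> m \<and> prefix (p @ [a]) (subst_range \<sigma> n m [b])}}"

lemma subfractal_eq: "subfractal \<sigma> u v n a = closure ((\<lambda>p. proj_along \<sigma> u v n (abelianization p)) ` address n a)"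
  by (simp add: subfractal_def address_def image_def setcompr_eq_image)

lemma closed_subfractal: "closed (subfractal \<sigma> u v n a)"
  by (simp add: subfractal_def)

text \<open>Beyond level \<open>k0\<close> all words are longer than \<open>p @ [a]\<close>, so all
  but finitely many witnesses (m, b) continue this prefix by a letter. As the alphabet is finite,
  one letter serves infinitely many of them.\<close>

lemma address_extend:
  assumes "p \<in> address n a"
  obtains a' where "p @ [a] \<in> address n a'"
proof -
  let ?P = "{(m, b). n \<le> m \<and> prefix (p @ [a]) (subst_range \<sigma> n m [b])}"
  let ?Q = "\<lambda>a'. {(m, b). n \<le> m \<and> prefix ((p @ [a]) @ [a']) (subst_range \<sigma> n m [b])}"
  obtain k0 where k0: "\<And>k b. k \<ge> k0 \<Longrightarrow> length (subst_range \<sigma> n k [b]) > length (p @ [a])"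
    using length_range_unbounded[of n "length (p @ [a])"] by blast
  have sub: "?P \<subseteq> {n..k0} \<times> UNIV \<union> (\<Union>a'. ?Q a')"
  proof
    fix x assume x: "x \<in> ?P"
    obtain m b where [simp]: "x = (m, b)" by (cases x)
    show "x \<in> {n..k0} \<times> UNIV \<union> (\<Union>a'. ?Q a')"
    proof (cases "m \<le> k0")
      case False
      obtain r where r: "subst_range \<sigma> n m [b] = p @ [a] @ r" using x by (auto simp: prefix_def)
      with k0[of m b] False obtain a' r' where "r = a' # r'" by (cases r) auto
      with r x have "x \<in> ?Q a'" by (auto simp: prefix_def)
      then show ?thesis by blast
    qed (use x in auto)
  qed
  have "infinite ?P" using assms by (simp add: address_def)
  then have "infinite ({n..k0} \<times> UNIV \<union> (\<Union>a'. ?Q a'))" using finite_subset[OF sub] by blast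
  then have "infinite (\<Union>a'. ?Q a')" by (simp only: finite_Un) simp
  then obtain a' where "infinite (?Q a')" by (meson finite_UN finite)
  then show ?thesis by (intro that[of a']) (simp add: address_def)
qed

text \<open>This is the domain exchange. Appending a to an address translates its projection by that
  of \<open>axis a 1\<close>, and the union of the finitely many closed subfractals absorbs
  limits.\<close>

lemma subfractal_exchange:
  assumes "z \<in> subfractal \<sigma> u v n a"
  obtains a' where "z + proj_along \<sigma> u v n (axis a 1) \<in> subfractal \<sigma> u v n a'"
proof -
  let ?\<pi> = "\<lambda>p. proj_along \<sigma> u v n (abelianization p)" and ?e = "proj_along \<sigma> u v n (axis a 1)"
  have "(+) ?e ` (?\<pi> ` address n a) \<subseteq> (\<Union>a'. ?\<pi> ` address n a')"
  proof safe
    fix p assume "p \<in> address n a"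
    then obtain a' where "p @ [a] \<in> address n a'" by (rule address_extend)
    moreover have "?e + ?\<pi> p = ?\<pi> (p @ [a])" by (simp add: proj_along_add)
    ultimately show "?e + ?\<pi> p \<in> (\<Union>a'. ?\<pi> ` address n a')" by blast
  qed
  moreover have "?\<pi> ` address n a' \<subseteq> subfractal \<sigma> u v n a'" for a'
    unfolding subfractal_eq by (rule closure_subset)
  moreover have "closed (\<Union>a'. subfractal \<sigma> u v n a')"
    by (intro closed_UN) (auto simp: closed_subfractal)
  ultimately have "closure ((+) ?e ` (?\<pi> ` address n a)) \<subseteq> (\<Union>a'. subfractal \<sigma> u v n a')"
    by (intro closure_minimal) blast+
  then have "?e + z \<in> (\<Union>a'. subfractal \<sigma> u v n a')"
    using assms by (auto simp: subfractal_eq closure_translation)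
  then show ?thesis using that by (auto simp: add.commute)
qed

text \<open>Every witness (k, c) for p at level n is also a witness for the refined word at level
  m.\<close>

lemma address_refine:
  assumes "m \<le> n" "p \<in> address n b" "prefix (q @ [a]) (subst_range \<sigma> m n [b])"
  shows "subst_range \<sigma> m n p @ q \<in> address m a"
proof -
  let ?P = "{(k, c). n \<le> k \<and> prefix (p @ [b]) (subst_range \<sigma> n k [c])}"
  let ?Q = "{(k, c). m \<le> k \<and> prefix ((subst_range \<sigma> m n p @ q) @ [a]) (subst_range \<sigma> m k [c])}"
  have "?P \<subseteq> ?Q"
  proof safe
    fix k c assume k: "n \<le> k" and pre: "prefix (p @ [b]) (subst_range \<sigma> n k [c])"
    show "m \<le> k" using k assms by simp
    obtain r where "subst_range \<sigma> n k [c] = (p @ [b]) @ r" using pre by (auto simp: prefix_def)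
    moreover obtain r' where "subst_range \<sigma> m n [b] = (q @ [a]) @ r'" using assms by (auto simp: prefix_def)
    moreover have "subst_range \<sigma> m k [c] = subst_range \<sigma> m n (subst_range \<sigma> n k [c])"
      using assms k by (simp add: subst_range_comp[of m n k])
    ultimately show "prefix ((subst_range \<sigma> m n p @ q) @ [a]) (subst_range \<sigma> m k [c])"
      using substitution_append[OF substitution_range, of m n "[b]" r]
      by (simp add: substitution_append[OF substitution_range])
  qed
  moreover have "infinite ?P" using assms by (simp add: address_def)
  ultimately show ?thesis using infinite_super by (auto simp: address_def)
qed

text \<open>One half of the set equation that expresses the subfractals of level m by those of level
  n: it holds for addresses, and continuity of the affine map extends it to closures.\<close>

lemma subfractal_refine:
  assumes "m \<le> n" "z \<in> subfractal \<sigma> u v n b" "prefix (q @ [a]) (subst_range \<sigma> m n [b])"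
  shows "inc_range \<sigma> m n *v z + proj_along \<sigma> u v m (abelianization q) \<in> subfractal \<sigma> u v m a"
proof -
  let ?\<pi> = "\<lambda>n p. proj_along \<sigma> u v n (abelianization p)"
  let ?f = "\<lambda>z. inc_range \<sigma> m n *v z + ?\<pi> m q"
  have "?f ` (?\<pi> n ` address n b) \<subseteq> ?\<pi> m ` address m a"
  proof safe
    fix p assume "p \<in> address n b"
    then have "subst_range \<sigma> m n p @ q \<in> address m a" using address_refine assms by blast
    moreover have "?f (?\<pi> n p) = ?\<pi> m (subst_range \<sigma> m n p @ q)"
      using assms by (simp add: proj_along_step abelianization_range proj_along_add)
    ultimately show "?f (?\<pi> n p) \<in> ?\<pi> m ` address m a" by blast
  qed
  moreover have "continuous_on S ?f" for S
    by (intro continuous_intros matrix_vector_mult_linear_continuous_on)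
  ultimately have "?f ` closure (?\<pi> n ` address n b) \<subseteq> closure (?\<pi> m ` address m a)"
    using closure_subset by (intro image_closure_subset) (blast intro: order_trans)+
  then show ?thesis using assms by (auto simp: subfractal_eq)
qed

text \<open>Each witness beyond level n desubstitutes to a pair \<open>(p', b)\<close>.
  Substitutions do not shorten words, so \<open>p'\<close> is no longer than p and there are
  finitely many pairs; one of them receives infinitely many witnesses.\<close>

lemma address_coarsen:
  assumes "m \<le> n" "p \<in> address m a"
  obtains p' b q where "p' \<in> address n b" "p = subst_range \<sigma> m n p' @ q"
    "prefix (q @ [a]) (subst_range \<sigma> m n [b])"
proof -
  let ?s = "subst_range \<sigma> m n"
  let ?P = "{(k, c). m \<le> k \<and> prefix (p @ [a]) (subst_range \<sigma> m k [c])}"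
  let ?Q = "\<lambda>(p', b). {(k, c). n \<le> k \<and> prefix (p' @ [b]) (subst_range \<sigma> n k [c])}"
  define I where "I = {(p', b). \<exists>q. p = ?s p' @ q \<and> prefix (q @ [a]) (?s [b])}"
  have "I \<subseteq> {xs. set xs \<subseteq> UNIV \<and> length xs \<le> length p} \<times> UNIV"
  proof safe
    fix p' b assume "(p', b) \<in> I"
    then have "length (?s p') \<le> length p" by (auto simp: I_def)
    then show "length p' \<le> length p"
      using length_substitution[OF substitution_range, of p' m n] by simp
  qed auto
  then have fin: "finite I"
    by (rule finite_subset) (intro finite_SigmaI finite_lists_length_le finite)
  have sub: "?P \<subseteq> {m..n} \<times> UNIV \<union> (\<Union>i\<in>I. ?Q i)"
  proof
    fix x assume x: "x \<in> ?P"
    obtain k c where [simp]: "x = (k, c)" by (cases x)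
    show "x \<in> {m..n} \<times> UNIV \<union> (\<Union>i\<in>I. ?Q i)"
    proof (cases "k \<le> n")
      case False
      then have "prefix (p @ [a]) (?s (subst_range \<sigma> n k [c]))"
        using x assms by (simp add: subst_range_comp[of m n k])
      then obtain p' b q where "prefix (p' @ [b]) (subst_range \<sigma> n k [c])" "p = ?s p' @ q" "prefix (q @ [a]) (?s [b])"
        by (rule prefix_substitution_split[OF substitution_range])
      then have "(p', b) \<in> I" "x \<in> ?Q (p', b)" using False by (auto simp: I_def)
      then show ?thesis by blast
    qed (use x in auto)
  qed
  have "infinite ?P" using assms by (simp add: address_def)
  then have "infinite ({m..n} \<times> UNIV \<union> (\<Union>i\<in>I. ?Q i))" using finite_subset[OF sub] by blast
  then have "infinite (\<Union>i\<in>I. ?Q i)" by (simp only: finite_Un) simp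
  then obtain i where "i \<in> I" "infinite (?Q i)" using fin by blast
  then show ?thesis using that by (auto simp: I_def address_def)
qed

text \<open>The other half of the set equation. The candidate pieces are finitely many affine images
  of closed sets under an injective map, so their union is closed and contains the closure of the
  projected addresses.\<close>

lemma subfractal_coarsen:
  assumes "m \<le> n" "z \<in> subfractal \<sigma> u v m a"
  obtains z' b q where "z' \<in> subfractal \<sigma> u v n b" "prefix (q @ [a]) (subst_range \<sigma> m n [b])"
    "z = inc_range \<sigma> m n *v z' + proj_along \<sigma> u v m (abelianization q)"
proof -
  let ?\<pi> = "\<lambda>n p. proj_along \<sigma> u v n (abelianization p)"
  define J where "J = {(b, q). prefix (q @ [a]) (subst_range \<sigma> m n [b])}"
  let ?f = "\<lambda>(b, q). (\<lambda>x. ?\<pi> m q + x) ` ((\<lambda>z. inc_range \<sigma> m n *v z) ` subfractal \<sigma> u v n b)"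
  \<comment> \<open>A pair is determined by b and the prefix \<open>q @ [a]\<close>, from which
    \<open>butlast\<close> recovers q.\<close>
  have "J \<subseteq> (\<Union>b. (\<lambda>r. (b, butlast r)) ` set (prefixes (subst_range \<sigma> m n [b])))"
    by (force simp: J_def image_iff)
  then have "finite J" by (rule finite_subset) auto
  have inj: "inj (\<lambda>z. inc_range \<sigma> m n *v z)"
    by (metis injI invertible_inc_range matrix_inv_mult_vec(2))
  have "closed (?f i)" for i
    using inj by (cases i) (auto intro!: closed_translation closed_injective_linear_image closed_subfractal)
  then have "closed (\<Union>i\<in>J. ?f i)" using \<open>finite J\<close> by blast
  moreover have "?\<pi> m ` address m a \<subseteq> (\<Union>i\<in>J. ?f i)"
  proof safe
    fix p assume "p \<in> address m a"
    then obtain p' b q where *: "p' \<in> address n b" "p = subst_range \<sigma> m n p' @ q"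
      "prefix (q @ [a]) (subst_range \<sigma> m n [b])"
      by (rule address_coarsen[OF assms(1)])
    then have "?\<pi> n p' \<in> subfractal \<sigma> u v n b"
      unfolding subfractal_eq by (intro closure_subset[THEN subsetD] imageI)
    moreover have "?\<pi> m p = ?\<pi> m q + inc_range \<sigma> m n *v ?\<pi> n p'"
      using assms * by (simp add: proj_along_step abelianization_range proj_along_add)
    ultimately have "?\<pi> m p \<in> ?f (b, q)" by blast
    then show "?\<pi> m p \<in> (\<Union>i\<in>J. ?f i)" using * by (auto simp: J_def)
  qed
  ultimately have "subfractal \<sigma> u v m a \<subseteq> (\<Union>i\<in>J. ?f i)"
    unfolding subfractal_eq by (rule closure_minimal[rotated])
  then obtain b q where "(b, q) \<in> J" "z \<in> ?f (b, q)" using assms(2) by auto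
  then show ?thesis using that[of _ b q] by (auto simp: J_def add.commute)
qed

end

section \<open>Null sets in a hyperplane\<close>

lemma negligible_linear_image:
  fixes f :: "'n::euclidean_space \<Rightarrow> 'n"
  assumes "linear f" "negligible S"
  shows "negligible (f ` S)"
  using assms by (intro negligible_differentiable_image_negligible) (auto intro: linear_imp_differentiable_on)

text \<open>Renaming coordinates permutes the sides of a box, and boxes determine the product
  measure. This identifies coordinates indexed by an orthonormal basis of a hyperplane with
  coordinates indexed by all but one standard basis vector.\<close>

lemma distr_lborel_PiM_reindex:
  fixes f :: "'b \<Rightarrow> 'i"
  assumes "bij_betw f B J" "finite B"
  shows "distr (\<Pi>\<^sub>M j\<in>J. (lborel :: real measure)) (\<Pi>\<^sub>M b\<in>B. lborel) (\<lambda>w. \<lambda>b\<in>B. w (f b)) = (\<Pi>\<^sub>M b\<in>B. lborel)"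
proof (rule product_sigma_finite.PiM_eqI)
  show "product_sigma_finite (\<lambda>b :: 'b. lborel :: real measure)"
    by standard
  interpret J: product_sigma_finite "\<lambda>j :: 'i. lborel :: real measure"
    by standard
  have finJ: "finite J" using assms bij_betw_finite by blast
  have fJ: "f b \<in> J" if "b \<in> B" for b using assms that by (auto simp: bij_betw_def)
  have [measurable]: "(\<lambda>w. \<lambda>b\<in>B. w (f b)) \<in> measurable (\<Pi>\<^sub>M j\<in>J. (lborel :: real measure)) (\<Pi>\<^sub>M b\<in>B. lborel)"
    using fJ by (intro measurable_restrict) (auto intro: measurable_component_singleton)
  fix A :: "'b \<Rightarrow> real set" assume A: "\<And>b. b \<in> B \<Longrightarrow> A b \<in> sets lborel"
  let ?g = "the_inv_into B f"
  have g: "?g (f b) = b" if "b \<in> B" for b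
    using assms that by (auto simp: bij_betw_def the_inv_into_f_f)
  have g': "?g j \<in> B" "f (?g j) = j" if "j \<in> J" for j
    using assms that by (auto simp: bij_betw_def the_inv_into_into f_the_inv_into_f)
  have "(\<lambda>w. \<lambda>b\<in>B. w (f b)) -` Pi\<^sub>E B A \<inter> space (\<Pi>\<^sub>M j\<in>J. (lborel :: real measure)) = (\<Pi>\<^sub>E j\<in>J. A (?g j))"
  proof (intro equalityI subsetI)
    fix w assume "w \<in> (\<lambda>w. \<lambda>b\<in>B. w (f b)) -` Pi\<^sub>E B A \<inter> space (\<Pi>\<^sub>M j\<in>J. (lborel :: real measure))"
    then have w: "w \<in> extensional J" "\<And>b. b \<in> B \<Longrightarrow> w (f b) \<in> A b"
      by (auto simp: space_PiM PiE_iff)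
    show "w \<in> (\<Pi>\<^sub>E j\<in>J. A (?g j))"
      using w(1) w(2)[OF g'(1)] g'(2) by (simp add: PiE_iff)
  next
    fix w assume "w \<in> (\<Pi>\<^sub>E j\<in>J. A (?g j))"
    then have w: "w \<in> extensional J" "\<And>j. j \<in> J \<Longrightarrow> w j \<in> A (?g j)"
      by (auto simp: PiE_iff)
    have "w (f b) \<in> A b" if "b \<in> B" for b
      using w(2)[OF fJ[OF that]] g[OF that] by simp
    then show "w \<in> (\<lambda>w. \<lambda>b\<in>B. w (f b)) -` Pi\<^sub>E B A \<inter> space (\<Pi>\<^sub>M j\<in>J. (lborel :: real measure))"
      using w(1) by (simp add: space_PiM PiE_iff)
  qed
  moreover have "emeasure (\<Pi>\<^sub>M j\<in>J. (lborel :: real measure)) (\<Pi>\<^sub>E j\<in>J. A (?g j)) = (\<Prod>j\<in>J. emeasure lborel (A (?g j)))"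
    using A g' finJ by (intro J.emeasure_PiM) auto
  moreover have "\<dots> = (\<Prod>b\<in>B. emeasure lborel (A b))"
    using prod.reindex_bij_betw[OF assms(1), of "\<lambda>j. emeasure lborel (A (?g j))"] g
    by (simp cong: prod.cong)
  ultimately show "emeasure (distr (\<Pi>\<^sub>M j\<in>J. lborel) (\<Pi>\<^sub>M b\<in>B. lborel) (\<lambda>w. \<lambda>b\<in>B. w (f b))) (Pi\<^sub>E B A)
      = (\<Prod>b\<in>B. emeasure lborel (A b))"
    using A assms by (subst emeasure_distr) (auto intro!: sets_PiM_I_finite)
qed (use assms in auto)

text \<open>A linear isomorphism takes \<open>u\<close> and a basis of \<open>S\<close> to the standard basis; there the set
  becomes a cylinder over its trace on \<open>S\<close>, so Fubini makes the trace null.\<close>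

lemma AE_lborel_subspace_transversal:
  fixes u :: "'a::euclidean_space"
  assumes S: "subspace S" "dim S = DIM('a) - 1" and u: "u \<notin> S"
    and N: "N \<in> sets borel" "negligible N"
    and inv: "\<And>z t. z \<in> N \<Longrightarrow> z + t *\<^sub>R u \<in> N"
  shows "AE z in lborel_subspace S. z \<notin> N"
proof -
  define B where "B = (SOME B. pairwise orthogonal B \<and> (\<forall>b\<in>B. norm b = 1) \<and> span B = S)"
  have "pairwise orthogonal B \<and> (\<forall>b\<in>B. norm b = 1) \<and> span B = S"
    unfolding B_def
  proof (rule someI_ex)
    show "\<exists>B. pairwise orthogonal B \<and> (\<forall>b\<in>B. norm b = 1) \<and> span B = S"
      using orthonormal_basis_subspace[OF S(1)] by metis
  qed
  then have B: "pairwise orthogonal B" "\<And>b. b \<in> B \<Longrightarrow> norm b = 1" "span B = S" by auto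
  have "independent B"
    using B(1) B(2)[of 0] by (intro pairwise_orthogonal_independent) auto
  then have fin: "finite B" using independent_bound by blast
  have cardB: "card B = DIM('a) - 1"
    using \<open>independent B\<close> B(3) S(2) dim_span[of B] dim_eq_card_independent by metis
  obtain i0 :: 'a where i0: "i0 \<in> Basis" using nonempty_Basis by blast
  let ?J = "Basis - {i0}"
  have "card B = card ?J" using cardB i0 by simp
  then obtain f where f: "bij_betw f B ?J"
    using fin finite_same_card_bij[of B ?J] by auto
  \<comment> \<open>\<open>L\<close> maps the standard basis to \<open>B\<close> and
    \<open>u\<close>; the isomorphism in the opposite direction is \<open>K\<close> below.\<close>
  define L where "L x = (\<Sum>b\<in>B. (x \<bullet> f b) *\<^sub>R b) + (x \<bullet> i0) *\<^sub>R u" for x :: 'a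
  have lin: "linear L"
    unfolding L_def by (intro linearI) (auto simp: inner_add_left scaleR_add_left scaleR_right_distrib sum.distrib scaleR_sum_right)
  have fJ: "f b \<in> Basis" "f b \<noteq> i0" if "b \<in> B" for b
    using f that by (auto simp: bij_betw_def)
  have L1: "L (f b) = b" if b: "b \<in> B" for b
  proof -
    have "(\<Sum>c\<in>B. (f b \<bullet> f c) *\<^sub>R c) = (\<Sum>c\<in>B. if c = b then c else 0)"
      using f b fJ by (intro sum.cong) (auto simp: inner_Basis bij_betw_def inj_on_def)
    then show ?thesis using b fin fJ i0 by (simp add: L_def inner_Basis)
  qed
  have L2: "L i0 = u"
  proof -
    have "i0 \<bullet> f b = 0" if "b \<in> B" for b
      using fJ[OF that] i0 by (auto simp: inner_Basis)
    then show ?thesis using i0 by (simp add: L_def)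
  qed
  have "range L = UNIV"
  proof -
    have "subspace (range L)" using lin by (simp add: linear_subspace_image)
    have "B \<subseteq> range L" using L1 by (metis rangeI subsetI)
    moreover have "u \<in> range L" using L2 by (metis rangeI)
    ultimately have sub: "span (insert u B) \<subseteq> range L"
      using \<open>subspace (range L)\<close> by (simp add: span_minimal)
    have "u \<notin> span B" using B u by simp
    then have ind: "independent (insert u B)"
      using \<open>independent B\<close> by (simp add: independent_insert)
    have "u \<notin> B" using \<open>u \<notin> span B\<close> span_base by blast
    then have "card (insert u B) = DIM('a)" using cardB fin by simp
    then have "span (insert u B) = UNIV"
      using card_eq_dim[of "insert u B" UNIV] ind fin by (auto simp: dim_UNIV)
    then show ?thesis using sub by auto
  qed
  then have inj: "inj L" using lin by (simp add: linear_surjective_imp_injective)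
  obtain K where K: "linear K" "\<And>x. K (L x) = x"
    using linear_injective_isomorphism[OF lin inj] by blast
  define N' where "N' = L -` N"
  have "continuous_on UNIV L" using lin by (simp add: linear_continuous_on linear_linear)
  then have "L \<in> borel_measurable borel" by (rule borel_measurable_continuous_onI)
  from measurable_sets[OF this N(1)] have N'm [measurable]: "N' \<in> sets borel" by (simp add: N'_def)
  have "N' \<subseteq> K ` N"
  proof
    fix x assume "x \<in> N'"
    then show "x \<in> K ` N" using K(2)[of x] by (metis N'_def imageI vimageD)
  qed
  then have "negligible N'" using negligible_linear_image[OF K(1) N(2)] negligible_subset by blast
  then have "emeasure lborel N' = 0"
    using N'm by (simp add: negligible_iff_null_sets null_sets_completion_iff null_sets_def)
  let ?\<phi> = "\<lambda>I w. \<Sum>b\<in>I. (w :: 'a \<Rightarrow> real) b *\<^sub>R b"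
  interpret product_sigma_finite "\<lambda>_ :: 'a. lborel :: real measure"
    by standard
  have Basis: "(Basis :: 'a set) = insert i0 ?J" using i0 by auto
  have \<phi>_measurable [measurable]:
    "?\<phi> I \<in> measurable (\<Pi>\<^sub>M b\<in>I. (lborel :: real measure)) borel" if "finite I" for I
    by measurable
  have [measurable]: "?\<phi> (insert i0 ?J) \<in> measurable (\<Pi>\<^sub>M b\<in>insert i0 ?J. (lborel :: real measure)) borel"
    by (rule \<phi>_measurable) simp
  have [measurable]: "?\<phi> ?J \<in> measurable (\<Pi>\<^sub>M b\<in>?J. (lborel :: real measure)) borel"
    by (rule \<phi>_measurable) simp
  have lborel: "(lborel :: 'a measure) = distr (\<Pi>\<^sub>M b\<in>insert i0 ?J. lborel) borel (?\<phi> (insert i0 ?J))"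
    unfolding Basis[symmetric] by (rule lborel_eq)
  \<comment> \<open>Invariance of \<open>N\<close> along \<open>u\<close> becomes invariance of
    \<open>N'\<close> along \<open>i0\<close>; the parameter \<open>- t\<close> gives the converse
    direction.\<close>
  have shift: "p + t *\<^sub>R i0 \<in> N' \<longleftrightarrow> p \<in> N'" for p t
    using inv[of "L p" t] inv[of "L p + t *\<^sub>R u" "- t"] lin L2
    by (auto simp: N'_def linear_add linear_cmul)
  have \<phi>_upd: "?\<phi> (insert i0 ?J) (w(i0 := t)) = ?\<phi> ?J w + t *\<^sub>R i0" for w t
    by (subst sum.insert) (auto simp: add.commute intro!: sum.cong)
  have "0 = (\<integral>\<^sup>+ p. indicator N' p \<partial>lborel)"
    using \<open>emeasure lborel N' = 0\<close> N'm by simp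
  also have "\<dots> = (\<integral>\<^sup>+ w. indicator N' (?\<phi> (insert i0 ?J) w) \<partial>(\<Pi>\<^sub>M b\<in>insert i0 ?J. lborel))"
    by (subst lborel, subst nn_integral_distr) auto
  also have "\<dots> = (\<integral>\<^sup>+ w. (\<integral>\<^sup>+ t. indicator N' (?\<phi> (insert i0 ?J) (w(i0 := t))) \<partial>lborel) \<partial>(\<Pi>\<^sub>M b\<in>?J. lborel))"
    by (rule product_nn_integral_insert) auto
  \<comment> \<open>The inner integrand does not depend on t, so its integral over the real line is
    infinite when the base point lies in \<open>N'\<close> and 0 otherwise. A vanishing total forces
    the second alternative almost everywhere.\<close>
  also have "\<dots> = (\<integral>\<^sup>+ w. \<infinity> * indicator N' (?\<phi> ?J w) \<partial>(\<Pi>\<^sub>M b\<in>?J. lborel))"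
    unfolding \<phi>_upd by (intro nn_integral_cong) (auto simp: shift indicator_def)
  finally have "AE w in (\<Pi>\<^sub>M b\<in>?J. lborel). \<infinity> * indicator N' (?\<phi> ?J w) = (0 :: ennreal)"
    by (subst (asm) eq_commute, subst (asm) nn_integral_0_iff_AE) auto
  then have AE: "AE w in (\<Pi>\<^sub>M b\<in>?J. lborel). ?\<phi> ?J w \<notin> N'"
    by (rule AE_mp) (auto simp: indicator_def split: if_splits)
  have L\<phi>: "(\<Sum>b\<in>B. w (f b) *\<^sub>R b) = L (?\<phi> ?J w)" for w
  proof -
    have "L (?\<phi> ?J w) = (\<Sum>j\<in>?J. w j *\<^sub>R L j)"
      using lin by (simp add: linear_sum linear_cmul)
    also have "\<dots> = (\<Sum>b\<in>B. w (f b) *\<^sub>R L (f b))"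
      using sum.reindex_bij_betw[OF f, of "\<lambda>j. w j *\<^sub>R L j"] by simp
    finally show ?thesis by (simp add: L1)
  qed
  have fm [measurable]: "(\<lambda>w. \<lambda>b\<in>B. w (f b)) \<in> measurable (\<Pi>\<^sub>M j\<in>?J. (lborel :: real measure)) (\<Pi>\<^sub>M b\<in>B. lborel)"
    using fJ by (intro measurable_restrict) (auto intro!: measurable_component_singleton)
  have "AE z in distr (distr (\<Pi>\<^sub>M j\<in>?J. (lborel :: real measure)) (\<Pi>\<^sub>M b\<in>B. lborel) (\<lambda>w. \<lambda>b\<in>B. w (f b)))
      borel (?\<phi> B). z \<notin> N"
    using AE N(1) fin
    by (simp add: AE_distr_iff distr_distr comp_def L\<phi> N'_def)
  then show ?thesis
    unfolding distr_lborel_PiM_reindex[OF f fin] lborel_subspace_def Let_def B_def[symmetric] .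
qed

section \<open>Overlaps along the flow direction\<close>

text \<open>The point z enters negated because Rauzy boxes are built from the negatives of
  subfractals. A segment of positive length is required so that successive tiles on a line may share
  an end point.\<close>

definition overlap_lines :: "'i set \<Rightarrow> ('i \<Rightarrow> 'a::euclidean_space set) \<Rightarrow> 'a \<Rightarrow> 'a set" where
  "overlap_lines I T u = {z. \<exists>i\<in>I. \<exists>j\<in>I. i \<noteq> j \<and>
     (\<exists>s t. s < t \<and> (\<forall>r\<in>{s..t}. r *\<^sub>R u - z \<in> T i \<inter> T j))}"

lemma overlap_linesI:
  assumes "i \<in> I" "j \<in> I" "i \<noteq> j" "s < t" "\<And>r. s \<le> r \<Longrightarrow> r \<le> t \<Longrightarrow> r *\<^sub>R u - z \<in> T i \<and> r *\<^sub>R u - z \<in> T j"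
  shows "z \<in> overlap_lines I T u"
  unfolding overlap_lines_def using assms
  by (intro CollectI bexI[of _ i] bexI[of _ j] conjI exI[of _ s] exI[of _ t]) auto

text \<open>Moving z along u only shifts the parameter interval. This is the invariance under which
  a null set of the whole space leaves a null trace on a transversal hyperplane.\<close>

lemma overlap_lines_translate:
  assumes "z \<in> overlap_lines I T u"
  shows "z + c *\<^sub>R u \<in> overlap_lines I T u"
proof -
  obtain i j s t where *: "i \<in> I" "j \<in> I" "i \<noteq> j" "s < t" "\<forall>r\<in>{s..t}. r *\<^sub>R u - z \<in> T i \<inter> T j"
    using assms by (auto simp: overlap_lines_def)
  show ?thesis
  proof (rule overlap_linesI)
    fix r assume "s + c \<le> r" "r \<le> t + c"
    then have "(r - c) *\<^sub>R u - z \<in> T i \<inter> T j" using * by auto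
    then show "r *\<^sub>R u - (z + c *\<^sub>R u) \<in> T i \<and> r *\<^sub>R u - (z + c *\<^sub>R u) \<in> T j"
      by (simp add: algebra_simps)
  qed (use * in auto)
qed

text \<open>Every segment of positive length contains one with rational end points, which makes the
  union countable when I is.\<close>

lemma overlap_lines_rational:
  "overlap_lines I T u = (\<Union>(i, j, s, t) \<in> {(i, j, s :: rat, t). i \<in> I \<and> j \<in> I \<and> i \<noteq> j \<and> s < t}.
     {z. \<forall>r\<in>{of_rat s..of_rat t}. r *\<^sub>R u - z \<in> T i \<inter> T j})" (is "?L = ?R")
proof (intro equalityI subsetI)
  fix z assume "z \<in> ?L"
  then obtain i j s t where *: "i \<in> I" "j \<in> I" "i \<noteq> j" "s < t" "\<forall>r\<in>{s..t}. r *\<^sub>R u - z \<in> T i \<inter> T j"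
    by (auto simp: overlap_lines_def)
  obtain p where p: "s < of_rat p" "of_rat p < t" using of_rat_dense[OF *(4)] by blast
  obtain q where q: "of_rat p < (of_rat q :: real)" "of_rat q < t" using of_rat_dense[OF p(2)] by blast
  have "p < q" using q by (simp add: of_rat_less)
  with p q * show "z \<in> ?R"
    by (intro UN_I[of "(i, j, p, q)"]) auto
next
  fix z assume "z \<in> ?R"
  then obtain i j s t where *: "i \<in> I" "j \<in> I" "i \<noteq> j" "s < t"
    "\<forall>r\<in>{of_rat s..of_rat t}. r *\<^sub>R u - z \<in> T i \<inter> T j" by auto
  then show "z \<in> ?L"
    by (intro overlap_linesI[of i I j "of_rat s" "of_rat t"]) (auto simp: of_rat_less)
qed

text \<open>For fixed tiles and rational end points, the set is an intersection of preimages of a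
  closed set, hence closed. Evaluation at the end point s alone puts it into a reflected translate
  of a null intersection of two tiles.\<close>

lemma overlap_lines_null:
  fixes T :: "'i \<Rightarrow> 'a::euclidean_space set"
  assumes tiling: "is_tiling I T" and I: "countable I"
  shows "overlap_lines I T u \<in> sets borel" "negligible (overlap_lines I T u)"
proof -
  let ?K = "{(i, j, s :: rat, t). i \<in> I \<and> j \<in> I \<and> i \<noteq> j \<and> s < t}"
  let ?C = "\<lambda>(i, j, s :: rat, t). {z. \<forall>r\<in>{of_rat s..of_rat t}. r *\<^sub>R u - z \<in> T i \<inter> T j}"
  have K: "countable ?K"
    by (rule countable_subset[of _ "I \<times> I \<times> UNIV"]) (use I in auto)
  have "closed (?C k)" if "k \<in> ?K" for k
  proof -
    obtain i j s t where k [simp]: "k = (i, j, s, t)" by (cases k)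
    have "?C k = (\<Inter>r\<in>{of_rat s..of_rat t}. (\<lambda>z. r *\<^sub>R u - z) -` (T i \<inter> T j))" by auto
    moreover have "closed (T i \<inter> T j)" using tiling that by (auto simp: is_tiling_def)
    ultimately show ?thesis
      by (simp only:) (rule closed_INT, rule ballI, rule closed_vimage, auto intro!: continuous_intros)
  qed
  then show "overlap_lines I T u \<in> sets borel"
    unfolding overlap_lines_rational by (intro sets.countable_UN'[OF K]) auto
  have "?C k \<in> null_sets lebesgue" if "k \<in> ?K" for k
  proof -
    obtain i j s t where k [simp]: "k = (i, j, s, t)" by (cases k)
    have "negligible (T i \<inter> T j)"
      using tiling that by (auto simp: is_tiling_def negligible_iff_null_sets)
    then have "negligible ((+) (of_rat s *\<^sub>R u) ` uminus ` (T i \<inter> T j))"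
      by (intro negligible_translation negligible_linear_image) (auto intro: linear_uminus)
    moreover have "?C k \<subseteq> (+) (of_rat s *\<^sub>R u) ` uminus ` (T i \<inter> T j)"
    proof
      fix z assume "z \<in> ?C k"
      moreover have "of_rat s \<le> (of_rat t :: real)" using that by (simp add: of_rat_less_eq)
      ultimately have "of_rat s *\<^sub>R u - z \<in> T i \<inter> T j" by auto
      moreover have "z = of_rat s *\<^sub>R u + - (of_rat s *\<^sub>R u - z)" by simp
      ultimately show "z \<in> (+) (of_rat s *\<^sub>R u) ` uminus ` (T i \<inter> T j)" by blast
    qed
    ultimately show ?thesis using negligible_iff_null_sets negligible_subset by blast
  qed
  then show "negligible (overlap_lines I T u)"
    unfolding overlap_lines_rational negligible_iff_null_sets by (rule null_sets_UN'[OF K])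
qed

section \<open>The Rauzy tiling and staircases of tiles along a line\<close>

locale tiling_seq = primitive_unimodular_seq \<sigma>
  for \<sigma> :: "int \<Rightarrow> 'd::finite list \<Rightarrow> 'd list" +
  fixes u v :: "real ^ 'd"
  assumes tiling: "tiling_condition \<sigma> u v"
begin

abbreviation A :: "int \<Rightarrow> int \<Rightarrow> real ^ 'd ^ 'd" where "A \<equiv> inc_range \<sigma>"
abbreviation U :: "int \<Rightarrow> real ^ 'd" where "U \<equiv> right_vec \<sigma> u"
abbreviation V :: "int \<Rightarrow> real ^ 'd" where "V \<equiv> left_vec \<sigma> v"
abbreviation proj :: "int \<Rightarrow> real ^ 'd \<Rightarrow> real ^ 'd" where "proj \<equiv> proj_along \<sigma> u v"
abbreviation R :: "int \<Rightarrow> 'd \<Rightarrow> (real ^ 'd) set" where "R \<equiv> subfractal \<sigma> u v"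
abbreviation Z :: "(real ^ 'd) set" where "Z \<equiv> int_lattice"

text \<open>A positive matrix turns the nonzero nonnegative vector v into a positive one. Positivity
  then persists because no column of an incidence matrix vanishes.\<close>

lemma left_vec_eventually_pos: "\<exists>N0\<ge>0. \<forall>N\<ge>N0. \<forall>a. V N $ a > 0"
proof -
  have v: "v \<in> nonneg_cone" "v \<noteq> 0" using tiling by (auto simp: tiling_condition_def gen_left_eigenvector_def)
  then obtain b where b: "v $ b > 0" by (force simp: nonneg_cone_def vec_eq_iff order.strict_iff_order)
  obtain N0 where N0: "N0 > 0" "\<And>a b. A 0 N0 $ a $ b > 0" using prim unfolding primitive_seq_def by meson
  have V: "V n $ a = (\<Sum>c\<in>UNIV. A m n $ c $ a * V m $ c)" if "m \<le> n" for m n a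
    using left_vec_step[OF that, of v] by (simp add: matrix_vector_mult_def transpose_def vec_eq_iff)
  have V0: "V 0 = v" by (simp add: left_vec_def transpose_mat)
  have pos0: "V N0 $ a > 0" for a
    unfolding V[of 0 N0 a, OF less_imp_le[OF N0(1)]] V0
    using N0 v b by (intro sum_pos2[of _ b]) (auto simp: nonneg_cone_def zero_le_mult_iff less_imp_le)
  have "V N $ a > 0" if "N \<ge> N0" for N a
  proof -
    obtain c where "A N0 N $ c $ a \<ge> 1"
      unfolding inc_range_def by (rule incidence_column_nonzero[OF substitution_range])
    then show ?thesis
      unfolding V[OF that] using pos0
      by (intro sum_pos2[of _ c]) (auto simp: zero_le_mult_iff less_imp_le inc_range_nonneg intro!: mult_pos_pos)
  qed
  then show ?thesis using N0 by (meson less_imp_le)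
qed

text \<open>The pairing is the same at all levels, so it can be evaluated where \<open>V N\<close>
  is positive; there \<open>U N\<close> is nonzero and nonnegative, since u lies in the image of the
  cone under \<open>A 0 N\<close>.\<close>

lemma right_inner_left_pos: "U n \<bullet> V n > 0"
proof -
  obtain N where N: "N \<ge> 0" "N \<ge> n" "\<And>a. V N $ a > 0"
    using left_vec_eventually_pos by (metis max.cobounded1 max.cobounded2 order_trans)
  have "u \<in> (\<Inter>n::nat. (\<lambda>x. A 0 (int n) *v x) ` nonneg_cone)" and u0: "u \<noteq> 0"
    using tiling by (auto simp: tiling_condition_def gen_right_eigenvector_def intro: exI[of _ 1])
  then have "u \<in> (\<lambda>x. A 0 N *v x) ` nonneg_cone" using N(1) by (metis INT_D UNIV_I nonneg_int_cases)
  then obtain x where x: "x \<in> nonneg_cone" "u = A 0 N *v x" by blast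
  then have UN: "U N = x" using N(1) by (simp add: right_vec_def matrix_inv_mult_vec)
  obtain a where a: "x $ a > 0" 
  proof -
    have "x \<noteq> 0" using x u0 by auto
    then show ?thesis using x that by (force simp: nonneg_cone_def vec_eq_iff order.strict_iff_order)
  qed
  have "U N \<bullet> V N > 0"
    unfolding UN inner_vec_def using a x N
    by (intro sum_pos2[of _ a]) (auto simp: nonneg_cone_def less_imp_le)
  then show ?thesis using right_inner_left_const[OF N(2), of u v] by simp
qed

text \<open>Normalized to pair to 1 with \<open>V n\<close>: for z orthogonal to \<open>V n\<close>,
  the parameter r of the line \<open>r *\<^sub>R flow n - z\<close> is the height measured by
  \<open>V n\<close>.\<close>

definition flow :: "int \<Rightarrow> real ^ 'd" where
  "flow n = (1 / (U n \<bullet> V n)) *\<^sub>R U n"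

lemma proj_eq: "proj n x = x - (x \<bullet> V n) *\<^sub>R flow n"
  by (simp add: proj_along_def flow_def)

lemma proj_onto_eq: "proj_onto \<sigma> u v n x = (x \<bullet> V n) *\<^sub>R flow n"
  by (simp add: proj_onto_def flow_def)

definition tile :: "int \<Rightarrow> (real ^ 'd) \<times> 'd \<Rightarrow> (real ^ 'd) set" where
  "tile n = (\<lambda>(x, a). (+) x ` rauzy_box \<sigma> u v n a)"

text \<open>Splitting y into \<open>proj n y\<close> and its multiple of \<open>flow n\<close>
  leaves the multiple \<open>r - y \<bullet> V n\<close> of the flow vector. It is the projection of
  the point \<open>t *\<^sub>R axis c 1\<close> of the segment, where t is its quotient by
  \<open>V n $ c\<close>.\<close>

lemma tile_mem:
  assumes "V n $ c > 0" "z + proj n y \<in> R n c" "y \<bullet> V n \<le> r" "r \<le> y \<bullet> V n + V n $ c"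
  shows "r *\<^sub>R flow n - z \<in> tile n (y, c)"
proof -
  define t where "t = (r - y \<bullet> V n) / V n $ c"
  have t: "0 \<le> t" "t \<le> 1" "t * V n $ c = r - y \<bullet> V n" using assms by (auto simp: t_def)
  have "t *\<^sub>R axis c 1 \<in> closed_segment 0 (axis c 1 :: real ^ 'd)"
    using t by (auto simp: in_segment)
  moreover have "proj_onto \<sigma> u v n (t *\<^sub>R axis c 1) = (r - y \<bullet> V n) *\<^sub>R flow n"
    using t by (simp add: proj_onto_eq inner_axis')
  ultimately have "(r - y \<bullet> V n) *\<^sub>R flow n - (z + proj n y) \<in> rauzy_box \<sigma> u v n c"
    using assms(2) unfolding rauzy_box_def by (metis (mono_tags, lifting) imageI mem_Collect_eq)
  moreover have "r *\<^sub>R flow n - z = y + ((r - y \<bullet> V n) *\<^sub>R flow n - (z + proj n y))"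
    by (simp add: proj_eq algebra_simps)
  ultimately show ?thesis unfolding tile_def case_prod_conv by (metis imageI)
qed

definition bad_top :: "int \<Rightarrow> (real ^ 'd) set" where
  "bad_top n = overlap_lines (Z \<times> UNIV) (tile n) (flow n)"

lemma bad_top_null: "bad_top n \<in> sets borel" "negligible (bad_top n)"
proof -
  have "is_tiling (Z \<times> UNIV) (tile n)" using tiling by (simp add: tiling_condition_def tile_def)
  moreover have "countable (Z \<times> (UNIV :: 'd set))" using countable_int_lattice by auto
  ultimately show "bad_top n \<in> sets borel" "negligible (bad_top n)"
    unfolding bad_top_def by (rule overlap_lines_null)+
qed

text \<open>The tiling is invariant under integer translations: x shifts both tile indices, and the
  parameter by \<open>x \<bullet> V n\<close>. A point outside the exceptional set thus keeps all
  its lattice translates outside.\<close>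

lemma bad_top_lattice:
  assumes "x \<in> Z" "z + proj n x \<in> bad_top n"
  shows "z \<in> bad_top n"
proof -
  obtain i j s t where *: "i \<in> Z \<times> UNIV" "j \<in> Z \<times> UNIV" "i \<noteq> j" "s < t"
    "\<And>r. r \<in> {s..t} \<Longrightarrow> r *\<^sub>R flow n - (z + proj n x) \<in> tile n i \<inter> tile n j"
    using assms(2) unfolding bad_top_def overlap_lines_def by blast
  let ?shift = "\<lambda>i. (x + fst i, snd i) :: (real ^ 'd) \<times> 'd"
  have tile: "tile n (?shift i) = (+) x ` tile n i" for i
    by (cases i) (auto simp: tile_def image_image add.assoc)
  show ?thesis
    unfolding bad_top_def
  proof (rule overlap_linesI)
    show "?shift i \<in> Z \<times> UNIV" "?shift j \<in> Z \<times> UNIV" "?shift i \<noteq> ?shift j"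
      using * assms by (auto intro: int_lattice_add simp: prod_eq_iff)
    show "s + x \<bullet> V n < t + x \<bullet> V n" using * by simp
    fix r assume "s + x \<bullet> V n \<le> r" "r \<le> t + x \<bullet> V n"
    then have "(r - x \<bullet> V n) *\<^sub>R flow n - (z + proj n x) \<in> tile n i \<inter> tile n j"
      using * by auto
    moreover have "r *\<^sub>R flow n - z = x + ((r - x \<bullet> V n) *\<^sub>R flow n - (z + proj n x))"
      by (simp add: proj_eq algebra_simps)
    ultimately show "r *\<^sub>R flow n - z \<in> tile n (?shift i) \<and> r *\<^sub>R flow n - z \<in> tile n (?shift j)"
      unfolding tile by blast
  qed
qed

text \<open>Two distinct tiles would share the part of the line from height
  \<open>x \<bullet> V n\<close> up to the lower of their two upper ends, a segment of positive
  length.\<close>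

lemma tile_unique:
  assumes pos: "\<And>a. V n $ a > 0" and z: "z \<notin> bad_top n"
    and y: "y \<in> Z" "z + proj n y \<in> R n c" and x: "x \<in> Z" "z + proj n x \<in> R n b"
    and le: "y \<bullet> V n \<le> x \<bullet> V n" "x \<bullet> V n < y \<bullet> V n + V n $ c"
  shows "y = x \<and> c = b"
proof (rule ccontr)
  assume "\<not> (y = x \<and> c = b)"
  have "z \<in> bad_top n"
    unfolding bad_top_def
  proof (rule overlap_linesI)
    show "(y, c) \<in> Z \<times> UNIV" "(x, b) \<in> Z \<times> UNIV" "(y, c) \<noteq> (x, b)"
      using y x \<open>\<not> (y = x \<and> c = b)\<close> by auto
    show "x \<bullet> V n < min (y \<bullet> V n + V n $ c) (x \<bullet> V n + V n $ b)" using le pos[of b] by simp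
    fix r assume "x \<bullet> V n \<le> r" "r \<le> min (y \<bullet> V n + V n $ c) (x \<bullet> V n + V n $ b)"
    then show "r *\<^sub>R flow n - z \<in> tile n (y, c) \<and> r *\<^sub>R flow n - z \<in> tile n (x, b)"
      using le y x by (auto intro!: tile_mem pos)
  qed
  then show False using z by simp
qed

text \<open>The domain exchange is followed from z until the height interval of the current tile
  contains \<open>x \<bullet> V n\<close>; that tile must be the one of x by
  \<open>tile_unique\<close>. The word read so far is then an itinerary with abelianization
  x.\<close>

lemma staircase:
  assumes pos: "\<And>a. V n $ a > 0" and z: "z \<notin> bad_top n"
    and a: "z \<in> R n a" and x: "x \<in> Z" "z + proj n x \<in> R n b" and ge: "x \<bullet> V n \<ge> 0"
  shows "x = 0 \<and> a = b \<or> (\<exists>q. x = abelianization (a # q))"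
proof -
  \<comment> \<open>The condition on \<open>hd\<close> records that the itinerary starts with a; for
    empty p it says that c is a.\<close>
  let ?step = "\<lambda>p c. hd (p @ [c]) = a \<and> z + proj n (abelianization p) \<in> R n c \<and> abelianization p \<bullet> V n \<le> x \<bullet> V n"
  have "\<exists>p c. ?step p c \<and> x \<bullet> V n < abelianization p \<bullet> V n + V n $ c"
  proof (rule ccontr)
    assume no: "\<nexists>p c. ?step p c \<and> x \<bullet> V n < abelianization p \<bullet> V n + V n $ c"
    \<comment> \<open>If the walk never passed the height of x, it would continue for any number k
      of steps below that height, although each step climbs at least the smallest entry of
      \<open>V n\<close>.\<close>
    have walk: "\<exists>p c. length p = k \<and> ?step p c" for k
    proof (induction k)
      case 0
      show ?case using a ge by (intro exI[of _ "[]"] exI[of _ a]) simp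
    next
      case (Suc k)
      then obtain p c where pc: "length p = k" "?step p c" by blast
      then have *: "abelianization p \<bullet> V n + V n $ c \<le> x \<bullet> V n" using no by force
      obtain c' where c': "(z + proj n (abelianization p)) + proj n (axis c 1) \<in> R n c'"
        using pc subfractal_exchange by blast
      have "?step (p @ [c]) c'"
        using pc c' * by (cases p) (simp_all add: proj_along_add inner_add_left inner_axis' add.assoc)
      then show ?case using pc by (intro exI[of _ "p @ [c]"] exI[of _ c']) simp
    qed
    define \<delta> where "\<delta> = Min (range (($) (V n)))"
    have \<delta>: "\<delta> > 0" "\<And>a. \<delta> \<le> V n $ a" using pos by (auto simp: \<delta>_def)
    have low: "real (length p) * \<delta> \<le> abelianization p \<bullet> V n" for p
    proof (induction p)
      case (Cons b p)
      then show ?case using \<delta>(2)[of b] by (simp add: inner_add_left inner_axis' algebra_simps)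
    qed simp
    obtain k :: nat where "x \<bullet> V n < real k * \<delta>" using \<delta>(1) reals_Archimedean3 by blast
    moreover obtain p c where "length p = k" "?step p c" using walk[of k] by blast
    ultimately show False using low[of p] by simp
  qed
  then obtain p c where p: "?step p c" "x \<bullet> V n < abelianization p \<bullet> V n + V n $ c" by blast
  then have "abelianization p = x \<and> c = b"
    using x by (intro tile_unique[OF pos z]) (auto intro: abelianization_int_lattice)
  then show ?thesis using p by (cases p) auto
qed

text \<open>For a separated \<open>z\<close>, a translate \<open>z + proj n x\<close> can lie in the fractal only if it is on the
  orbit of \<open>z\<close> under the domain exchange that adds \<open>proj n (axis a 1)\<close> on \<open>R n a\<close>.\<close>

definition separated :: "int \<Rightarrow> real ^ 'd \<Rightarrow> bool" where
  "separated n z \<longleftrightarrow> (\<forall>a b x. x \<in> Z \<and> z \<in> R n a \<and> z + proj n x \<in> R n b \<longrightarrow>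
     x = 0 \<and> a = b \<or> (\<exists>q. x = abelianization (a # q)) \<or> (\<exists>q. - x = abelianization (b # q)))"

text \<open>For x of negative height the two end points change roles: the staircase starts at
  \<open>z + proj n x\<close> and reaches z by \<open>- x\<close>.\<close>

lemma separated_top:
  assumes pos: "\<And>a. V n $ a > 0" and z: "z \<notin> bad_top n"
  shows "separated n z"
  unfolding separated_def
proof safe
  fix a b x assume x: "x \<in> Z" "z \<in> R n a" "z + proj n x \<in> R n b"
    and no: "\<nexists>q. - x = abelianization (b # q)" "\<nexists>q. x = abelianization (a # q)"
  have "x = 0 \<and> a = b"
  proof (cases "x \<bullet> V n \<ge> 0")
    case True
    then show ?thesis using staircase[OF pos z] x no by blast
  next
    case False
    have ret: "(z + proj n x) + proj n (- x) = z" by (simp add: proj_along_minus)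
    have "z + proj n x \<notin> bad_top n" using bad_top_lattice[OF x(1)] z by blast
    moreover have "z + proj n x + proj n (- x) \<in> R n a" unfolding ret by (rule x(2))
    moreover have "- x \<in> Z" "- x \<bullet> V n \<ge> 0" using x(1) False by (auto intro: int_lattice_minus)
    ultimately have "- x = 0 \<and> b = a \<or> (\<exists>q. - x = abelianization (b # q))"
      using staircase[OF pos _ x(3)] by blast
    then show ?thesis using no by auto
  qed
  then show "x = 0" "a = b" by auto
qed

section \<open>Exceptional sets at lower levels and descent of separation\<close>

definition bad :: "int \<Rightarrow> int \<Rightarrow> (real ^ 'd) set" where
  "bad N n = {z. matrix_inv (A n N) *v z \<in> bad_top N}"

lemma inv_range_proj:
  "n \<le> N \<Longrightarrow> matrix_inv (A n N) *v proj n x = proj N (matrix_inv (A n N) *v x)"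
  by (simp add: matrix_inv_mult_eq_iff proj_along_step matrix_inv_mult_vec)

lemma bad_lattice:
  assumes "n \<le> N" "x \<in> Z" "z \<notin> bad N n"
  shows "z + proj n x \<notin> bad N n"
  using assms bad_top_lattice[of "matrix_inv (A n N) *v x" "matrix_inv (A n N) *v z" N]
  by (auto simp: bad_def matrix_vector_right_distrib inv_range_proj inv_inc_range_int_lattice)

lemma bad_range:
  assumes "m \<le> n" "n \<le> N" "z \<notin> bad N n"
  shows "A m n *v z \<notin> bad N m"
proof -
  have "matrix_inv (A m N) *v (A m n *v z) = matrix_inv (A n N) *v z"
    using assms by (simp add: matrix_inv_mult_eq_iff inc_range_vec_comp[symmetric, of m n N] matrix_inv_mult_vec)
  then show ?thesis using assms by (simp add: bad_def)
qed

text \<open>The set is a linear image of a null set, and it is invariant along \<open>U n\<close>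
  because the inverse matrix maps \<open>U n\<close> to \<open>U N\<close>, a multiple of
  \<open>flow N\<close>. The positive pairing makes \<open>U n\<close> transversal to the
  hyperplane.\<close>

lemma AE_not_bad:
  assumes "n \<le> N"
  shows "AE z in lborel_subspace {x. x \<bullet> V n = 0}. z \<notin> bad N n"
proof (rule AE_lborel_subspace_transversal)
  let ?S = "{x. x \<bullet> V n = 0}"
  have eq: "?S = {x. V n \<bullet> x = 0}" by (simp add: inner_commute)
  show "subspace ?S" unfolding eq by (rule subspace_hyperplane)
  have "V n \<noteq> 0" using right_inner_left_pos[of n] by auto
  then show "dim ?S = DIM(real ^ 'd) - 1" unfolding eq by (rule dim_hyperplane)
  show "U n \<notin> ?S" using right_inner_left_pos[of n] by simp
  let ?M = "\<lambda>z. matrix_inv (A n N) *v z"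
  have vimage: "bad N n = ?M -` bad_top N" by (auto simp: bad_def)
  have "?M \<in> borel_measurable borel"
    by (intro borel_measurable_continuous_onI matrix_vector_mult_linear_continuous_on)
  from measurable_sets[OF this bad_top_null(1)] show "bad N n \<in> sets borel"
    by (simp add: vimage)
  have "bad N n \<subseteq> (\<lambda>z. A n N *v z) ` bad_top N"
  proof
    fix z assume "z \<in> bad N n"
    then show "z \<in> (\<lambda>z. A n N *v z) ` bad_top N"
      using matrix_inv_mult_vec(1)[of "A n N" z] by (intro image_eqI[of _ _ "?M z"]) (auto simp: bad_def)
  qed
  moreover have "negligible ((\<lambda>z. A n N *v z) ` bad_top N)"
    by (intro negligible_linear_image bad_top_null) simp
  ultimately show "negligible (bad N n)" using negligible_subset by blast
  fix z t assume z: "z \<in> bad N n"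
  have "?M (U n) = U N" using right_vec_step[OF assms] by (simp add: matrix_inv_mult_eq_iff)
  moreover have "U N = (U N \<bullet> V N) *\<^sub>R flow N" using right_inner_left_pos[of N] by (simp add: flow_def)
  ultimately have "?M (z + t *\<^sub>R U n) = ?M z + (t * (U N \<bullet> V N)) *\<^sub>R flow N"
    by (metis matrix_vector_mult_scaleR matrix_vector_right_distrib scaleR_scaleR)
  then show "z + t *\<^sub>R U n \<in> bad N n"
    using z overlap_lines_translate by (simp add: bad_def bad_top_def)
qed

text \<open>Both points are coarsened to level N, where they lie at \<open>z1\<close> and
  \<open>z2\<close> and differ by the projection of a lattice vector y. Separation at level N makes
  y trivial or an itinerary up to sign, and substituting this itinerary and trimming it by the
  offsets \<open>q1\<close> and \<open>q2\<close> gives the one for x.\<close>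

lemma separated_down:
  assumes le: "m \<le> N" and pos: "\<And>a. V N $ a > 0" and z: "z \<notin> bad N m"
  shows "separated m z"
  unfolding separated_def
proof safe
  let ?s = "subst_range \<sigma> m N"
  fix a b x assume x: "x \<in> Z" "z \<in> R m a" "z + proj m x \<in> R m b"
    and no: "\<nexists>q. - x = abelianization (b # q)" "\<nexists>q. x = abelianization (a # q)"
  obtain z1 c1 q1 where 1: "z1 \<in> R N c1" "prefix (q1 @ [a]) (?s [c1])"
    "z = A m N *v z1 + proj m (abelianization q1)"
    using subfractal_coarsen[OF le x(2)] by blast
  obtain z2 c2 q2 where 2: "z2 \<in> R N c2" "prefix (q2 @ [b]) (?s [c2])"
    "z + proj m x = A m N *v z2 + proj m (abelianization q2)"
    using subfractal_coarsen[OF le x(3)] by blast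
  \<comment> \<open>The displacement from \<open>A m N *v z1\<close> to \<open>A m N *v z2\<close>,
    that is, x corrected by the two offsets.\<close>
  define w where "w = x + abelianization q1 - abelianization q2"
  define y where "y = matrix_inv (A m N) *v w"
  have w: "w = A m N *v y" by (simp add: y_def matrix_inv_mult_vec)
  have "w \<in> Z" using x by (auto simp: w_def intro!: int_lattice_add int_lattice_diff abelianization_int_lattice)
  then have y: "y \<in> Z" by (simp add: y_def inv_inc_range_int_lattice)
  have "A m N *v z2 = A m N *v z1 + proj m w"
    using 1 2 by (simp add: w_def proj_along_add proj_along_diff algebra_simps)
  then have "A m N *v z2 = A m N *v (z1 + proj N y)"
    by (simp add: w matrix_vector_right_distrib proj_along_step[OF le])
  then have z2: "z2 = z1 + proj N y" by (metis invertible_inc_range matrix_inv_mult_vec(2))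
  have "A m N *v z1 = z + proj m (- abelianization q1)" using 1 by (simp add: proj_along_minus)
  then have "A m N *v z1 \<notin> bad N m"
    using bad_lattice[OF le _ z] by (simp add: abelianization_int_lattice int_lattice_minus)
  then have "z1 \<notin> bad_top N" by (simp add: bad_def matrix_inv_mult_vec)
  then have "separated N z1" by (rule separated_top[OF pos])
  then consider "y = 0" "c1 = c2" | q where "y = abelianization (c1 # q)" | q where "- y = abelianization (c2 # q)"
    using y 1 2 z2 unfolding separated_def by blast
  then have "x = 0 \<and> a = b"
  proof cases
    \<comment> \<open>Both positions lie in the same word \<open>?s [c1]\<close>, so x counts the
      letters between them, with the sign given by their order.\<close>
    case 1
    then have xeq: "x = abelianization q2 - abelianization q1" using w by (simp add: w_def algebra_simps)
    obtain r1 where "?s [c1] = q1 @ a # r1" using \<open>prefix (q1 @ [a]) _\<close> by (auto simp: prefix_def)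
    moreover obtain r2 where "?s [c1] = q2 @ b # r2" using \<open>prefix (q2 @ [b]) _\<close> 1 by (auto simp: prefix_def)
    ultimately have "q1 @ a # r1 = q2 @ b # r2" by simp
    then consider "q1 = q2" "a = b" | t where "q2 = q1 @ a # t" | t where "q1 = q2 @ b # t"
      by (auto simp: append_eq_append_conv2 Cons_eq_append_conv append_eq_Cons_conv)
    then show ?thesis
    proof cases
      case 1
      then show ?thesis using xeq by simp
    next
      case (2 t)
      then have "x = abelianization (a # t)" using xeq by simp
      then show ?thesis using no by blast
    next
      case (3 t)
      then have "- x = abelianization (b # t)" using xeq by simp
      then show ?thesis using no by blast
    qed
  next
    case (2 q)
    obtain r where r: "?s [c1] = q1 @ a # r" using 1 by (auto simp: prefix_def)
    have "w = abelianization (?s (c1 # q))" by (simp add: w 2 abelianization_range)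
    also have "\<dots> = abelianization (q1 @ a # r) + abelianization (?s q)"
      by (subst substitution_Cons[OF substitution_range]) (simp add: r)
    finally have "x = abelianization (a # r @ ?s q @ q2)" by (simp add: w_def algebra_simps)
    then show ?thesis using no by blast
  next
    case (3 q)
    obtain r where r: "?s [c2] = q2 @ b # r" using 2 by (auto simp: prefix_def)
    have "- w = A m N *v (- y)" using matrix_vector_mult_diff_distrib[of "A m N" 0 y] by (simp add: w)
    also have "\<dots> = abelianization (?s (c2 # q))" unfolding 3 by (simp add: abelianization_range)
    also have "\<dots> = abelianization (q2 @ b # r) + abelianization (?s q)"
      by (subst substitution_Cons[OF substitution_range]) (simp add: r)
    finally have "x + abelianization (b # r @ ?s q @ q1) = 0" by (simp add: w_def algebra_simps)
    then have "- x = abelianization (b # r @ ?s q @ q1)" by (rule minus_unique)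
    then show ?thesis using no by blast
  qed
  then show "x = 0" "a = b" by auto
qed

end

section \<open>The induced rotation\<close>

lemma induced_map_eq:
  assumes "x \<in> Y" "k \<ge> 1" "partial_iterate F k x = Some y" "y \<in> Y"
    and "\<And>j. 1 \<le> j \<Longrightarrow> j < k \<Longrightarrow> partial_iterate F j x \<notin> Some ` Y"
  shows "induced_map F Y x = Some y"
proof -
  have "(LEAST k. k \<ge> 1 \<and> partial_iterate F k x \<in> Some ` Y) = k"
    using assms by (intro Least_equality) (auto simp: not_less[symmetric])
  then show ?thesis using assms by (auto simp: induced_map_def)
qed

lemma partial_iterate_simps:
  "partial_iterate F 0 x = Some x"
  "partial_iterate F (Suc k) x = Option.bind (partial_iterate F k x) F"
  by (simp_all add: partial_iterate_def)

locale tiling_rotation = tiling_seq \<sigma> u v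
  for \<sigma> :: "int \<Rightarrow> 'd::{finite,linorder} list \<Rightarrow> 'd list" and u v :: "(real, 'd) vec"
begin

text \<open>The exchanged point is a valid representative since \<open>axis a 1\<close> minus the
  last basis vector has coordinate sum 0. Another representative would differ from it by the
  projection of a lattice vector y with coordinate sum 0; separation forces y to vanish, as a
  nonempty word has positive length.\<close>

lemma rotation_eq:
  assumes le: "m \<le> N" and pos: "\<And>a. V N $ a > 0" and z: "z \<notin> bad N m" "z \<in> R m a"
  shows "rotation \<sigma> u v m z = Some (z + proj m (axis a 1))"
proof -
  let ?e = "axis (Max UNIV) 1 :: (real, 'd) vec"
  let ?P = "\<lambda>w. w \<in> fractal \<sigma> u v m \<and> w - (z + proj m ?e) \<in> translation_lattice \<sigma> u v m"
  let ?w = "z + proj m (axis a 1)"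
  obtain a' where a': "?w \<in> R m a'" using subfractal_exchange z(2) by blast
  have "?w - (z + proj m ?e) = proj m (axis a 1 - ?e)" by (simp add: proj_along_diff)
  moreover have "axis a 1 - ?e \<in> Z \<inter> {x. x \<bullet> 1 = 0}"
    by (auto simp: int_lattice_diff int_lattice_axis inner_diff_left inner_axis')
  ultimately have Pw: "?P ?w"
    unfolding translation_lattice_def using a' by (auto simp: fractal_def)
  have uniq: "w = ?w" if w: "?P w" for w
  proof -
    obtain b where b: "w \<in> R m b" using w by (auto simp: fractal_def)
    obtain x where x: "x \<in> Z" "x \<bullet> 1 = 0" "w - (z + proj m ?e) = proj m x"
      using w by (auto simp: translation_lattice_def)
    define y where "y = x + ?e - axis a 1"
    have y: "y \<in> Z" "y \<bullet> 1 = 0"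
      using x by (auto simp: y_def int_lattice_add int_lattice_diff int_lattice_axis
          inner_add_left inner_diff_left inner_axis')
    have w_eq: "w = ?w + proj m y" using x(3) by (simp add: y_def proj_along_add proj_along_diff algebra_simps)
    have "?w \<notin> bad N m" using bad_lattice[OF le int_lattice_axis z(1)] .
    then have "separated m ?w" by (rule separated_down[OF le pos])
    moreover have "abelianization (c # q) \<bullet> 1 \<noteq> 0" for c :: 'd and q
      using abelianization_inner_1[of "c # q"] by simp
    then have "y \<noteq> abelianization (c # q)" "- y \<noteq> abelianization (c # q)" for c q
      using y(2) by (metis inner_minus_left neg_equal_0_iff_equal)+
    ultimately have "y = 0" using a' b y(1) unfolding separated_def w_eq by blast
    then show ?thesis using w_eq by simp
  qed
  have "\<exists>!w. ?P w" using Pw uniq by (rule ex1I)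
  moreover have "(THE w. ?P w) = ?w" using Pw uniq by (rule the_equality)
  moreover have "z \<in> fractal \<sigma> u v m" using z(2) by (auto simp: fractal_def)
  ultimately show ?thesis unfolding rotation_def Let_def by simp
qed

lemma range_fractal_subset:
  assumes "m \<le> n"
  shows "(\<lambda>z. A m n *v z) ` fractal \<sigma> u v n \<subseteq> fractal \<sigma> u v m"
proof safe
  fix z assume "z \<in> fractal \<sigma> u v n"
  then obtain b where b: "z \<in> R n b" by (auto simp: fractal_def)
  obtain a w where "subst_range \<sigma> m n [b] = a # w"
    using substitution_letter[OF substitution_range] by (meson list.exhaust)
  then have "prefix ([] @ [a]) (subst_range \<sigma> m n [b])" by simp
  from subfractal_refine[OF assms b this] show "A m n *v z \<in> fractal \<sigma> u v m"
    by (auto simp: fractal_def)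
qed

text \<open>The return time is the length of \<open>?W\<close>: the k-th iterate adds the projection
  of the prefix of length k. Separation at level n excludes earlier returns.\<close>

lemma induced_rotation:
  assumes le: "m \<le> n" "n \<le> N" and pos: "\<And>a. V N $ a > 0" and z: "z \<notin> bad N n" "z \<in> R n b"
  shows "induced_map (rotation \<sigma> u v m) ((\<lambda>y. A m n *v y) ` fractal \<sigma> u v n) (A m n *v z) =
    Some (A m n *v (z + proj n (axis b 1)))"
proof -
  let ?W = "subst_range \<sigma> m n [b]" and ?Y = "(\<lambda>y. A m n *v y) ` fractal \<sigma> u v n"
  let ?z = "\<lambda>k. A m n *v z + proj m (abelianization (take k ?W))"
  have Az: "A m n *v z \<notin> bad N m" by (rule bad_range[OF le z(1)])
  have iter: "partial_iterate (rotation \<sigma> u v m) k (A m n *v z) = Some (?z k)" if "k \<le> length ?W" for k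
    using that
  proof (induction k)
    case (Suc k)
    have take: "take (Suc k) ?W = take k ?W @ [?W ! k]"
      using Suc.prems by (simp add: take_Suc_conv_app_nth)
    have "prefix (take k ?W @ [?W ! k]) ?W" unfolding take[symmetric] by (rule take_is_prefix)
    then have "?z k \<in> R m (?W ! k)" by (rule subfractal_refine[OF le(1) z(2)])
    moreover have "?z k \<notin> bad N m"
      using le Az by (intro bad_lattice) (auto intro: abelianization_int_lattice)
    ultimately have "rotation \<sigma> u v m (?z k) = Some (?z k + proj m (axis (?W ! k) 1))"
      using le pos by (intro rotation_eq[of m N]) auto
    also have "?z k + proj m (axis (?W ! k) 1) = ?z (Suc k)"
      by (simp add: take proj_along_add)
    finally show ?case using Suc by (simp add: partial_iterate_simps)
  qed (simp add: partial_iterate_simps)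
  have sep: "separated n z" using le(2) pos z(1) by (rule separated_down)
  have no_return: "?z k \<notin> ?Y" if k: "1 \<le> k" "k < length ?W" for k
  proof
    let ?p = "abelianization (take k ?W)"
    have p1: "?p \<bullet> 1 = real k" using k by (simp add: abelianization_inner_1)
    assume "?z k \<in> ?Y"
    then obtain w c where w: "?z k = A m n *v w" "w \<in> R n c" by (auto simp: fractal_def)
    define y where "y = matrix_inv (A m n) *v ?p"
    have y: "y \<in> Z" "A m n *v y = ?p"
      by (auto simp: y_def inv_inc_range_int_lattice abelianization_int_lattice matrix_inv_mult_vec)
    then have "A m n *v w = A m n *v (z + proj n y)"
      using w le by (simp add: matrix_vector_right_distrib proj_along_step)
    then have "w = z + proj n y" by (metis invertible_inc_range matrix_inv_mult_vec(2))
    then consider "y = 0" | q where "y = abelianization (b # q)" | q where "- y = abelianization (c # q)"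
      using sep z(2) w(2) y(1) unfolding separated_def by blast
    \<comment> \<open>Coordinate sums refute each case: that of \<open>?p\<close> is k, positive and
      below the length of \<open>?W\<close>, whereas the cases force it to be 0, at least the length
      of \<open>?W\<close>, or at most 0.\<close>
    then show False
    proof cases
      case 1
      then show ?thesis using y p1 k by simp
    next
      case (2 q)
      then have "?p = abelianization (subst_range \<sigma> m n (b # q))"
        using y by (simp only: abelianization_range)
      also have "\<dots> = abelianization (?W @ subst_range \<sigma> m n q)"
        by (subst substitution_Cons[OF substitution_range]) simp
      finally have "?p \<bullet> 1 = real (length (?W @ subst_range \<sigma> m n q))"
        by (simp only: abelianization_inner_1)
      then show ?thesis using p1 k by simp
    next
      case (3 q)
      have "A m n *v (- y) = - ?p"
        using matrix_vector_mult_diff_distrib[of "A m n" 0 y] y by simp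
      then have "- ?p = abelianization (subst_range \<sigma> m n (c # q))"
        using 3 by (simp only: abelianization_range)
      then have "- ?p \<bullet> 1 = real (length (subst_range \<sigma> m n (c # q)))"
        by (metis abelianization_inner_1)
      then show ?thesis using p1 k by simp
    qed
  qed
  have end_point: "?z (length ?W) = A m n *v (z + proj n (axis b 1))"
    using abelianization_range[of m n "[b]"] le
    by (simp add: matrix_vector_right_distrib proj_along_step)
  show ?thesis
  proof (rule induced_map_eq)
    show "A m n *v z \<in> ?Y" using z(2) by (auto simp: fractal_def)
    show "1 \<le> length ?W" using substitution_letter[OF substitution_range, of m n b] by (cases ?W) auto
    show "partial_iterate (rotation \<sigma> u v m) (length ?W) (A m n *v z) = Some (A m n *v (z + proj n (axis b 1)))"
      unfolding end_point[symmetric] by (rule iter) simp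
    obtain b' where "z + proj n (axis b 1) \<in> R n b'" using subfractal_exchange z(2) by blast
    then show "A m n *v (z + proj n (axis b 1)) \<in> ?Y" by (auto simp: fractal_def)
    show "partial_iterate (rotation \<sigma> u v m) j (A m n *v z) \<notin> Some ` ?Y" if "1 \<le> j" "j < length ?W" for j
      using no_return[OF that] iter[of j] that by auto
  qed
qed

end

theorem theoremC:
  fixes \<sigma> :: "int \<Rightarrow> 'd::{finite,linorder} list \<Rightarrow> 'd list"
    and u v :: "(real, 'd) vec"
    and m n :: int
  assumes "CARD('d) \<ge> 2"
    and "\<And>k. substitution (\<sigma> k)"
    and "\<And>k. unimodular (\<sigma> k)"
    and "tiling_condition \<sigma> u v"
    and "\<And>k. compact (fractal \<sigma> u v k)"
    and "m < n"
  shows "(\<lambda>z. inc_range \<sigma> m n *v z) ` fractal \<sigma> u v n \<subseteq> fractal \<sigma> u v m \<and>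
    (AE z in lborel_subspace {x. x \<bullet> left_vec \<sigma> v n = 0}. z \<in> fractal \<sigma> u v n \<longrightarrow>
      (\<exists>w. rotation \<sigma> u v n z = Some w \<and>
        induced_map (rotation \<sigma> u v m) ((\<lambda>y. inc_range \<sigma> m n *v y) ` fractal \<sigma> u v n)
          (inc_range \<sigma> m n *v z) = Some (inc_range \<sigma> m n *v w)))"
proof -
  interpret tiling_rotation \<sigma> u v
    using assms by unfold_locales (auto simp: tiling_condition_def)
  have le: "m \<le> n" using assms by simp
  \<comment> \<open>A single N serves both levels, since \<open>A m n\<close> maps points outside
    \<open>bad N n\<close> to points outside \<open>bad N m\<close>.\<close>
  obtain N where N: "n \<le> N" "\<And>a. V N $ a > 0"
    using left_vec_eventually_pos by (metis max.cobounded1 max.cobounded2)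
  show ?thesis
  proof
    show "(\<lambda>z. inc_range \<sigma> m n *v z) ` fractal \<sigma> u v n \<subseteq> fractal \<sigma> u v m"
      by (rule range_fractal_subset[OF le])
    show "AE z in lborel_subspace {x. x \<bullet> left_vec \<sigma> v n = 0}. z \<in> fractal \<sigma> u v n \<longrightarrow>
      (\<exists>w. rotation \<sigma> u v n z = Some w \<and>
        induced_map (rotation \<sigma> u v m) ((\<lambda>y. inc_range \<sigma> m n *v y) ` fractal \<sigma> u v n)
          (inc_range \<sigma> m n *v z) = Some (inc_range \<sigma> m n *v w))"
      using AE_not_bad[OF N(1)]
    proof (rule AE_mp, intro AE_I2 impI)
      fix z assume z: "z \<notin> bad N n" "z \<in> fractal \<sigma> u v n"
      then obtain b where b: "z \<in> R n b" by (auto simp: fractal_def)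
      show "\<exists>w. rotation \<sigma> u v n z = Some w \<and>
        induced_map (rotation \<sigma> u v m) ((\<lambda>y. inc_range \<sigma> m n *v y) ` fractal \<sigma> u v n)
          (inc_range \<sigma> m n *v z) = Some (inc_range \<sigma> m n *v w)"
        using rotation_eq[OF N(1) N(2) z(1) b] induced_rotation[OF le N(1) N(2) z(1) b] by blast
    qed
  qed
qed

end
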